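(* Let $\alpha$ be a badly approximable irrational. Then for all integers $M\ge 3$, \[ \frac1M\sum_{N=1}^M \log P_N(\alpha)=\frac12\log M+O(\log\log M) \] and \[ \log M\ll \frac1M\sum_{N=1}^M\left(\log P_N(\alpha)-\frac12\log M\right)^2\ll \log M, \] with implied (positive) constants depending only on $\alpha$.
   Context: The Sudler product is $P_N(\alpha)=\prod_{n=1}^N |2\sin(\pi n\alpha)|$. $\|\cdot\|$ denotes the distance from the nearest integer. An irrational $\alpha$ is badly approximable if $\inf_{q\ge 1} q\|q\alpha\|>0$, where $q$ ranges over positive integers. $X\ll Y$ means $|X|\le CY$ with an implied constant $C>0$. *)

theory Defs
  imports Complex_Main
begin

definition dist_nearest_int :: "real \<Rightarrow> real" where
  "dist_nearest_int x = \<bar>x - of_int (round x)\<bar>"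

definition badly_approximable :: "real \<Rightarrow> bool" where
  "badly_approximable \<alpha> \<longleftrightarrow>
     \<alpha> \<notin> \<rat> \<and> (INF q\<in>{1::nat..}. real q * dist_nearest_int (real q * \<alpha>)) > 0"

definition sudler :: "nat \<Rightarrow> real \<Rightarrow> real" where
  "sudler N \<alpha> = (\<Prod>n=1..N. \<bar>2 * sin (pi * real n * \<alpha>)\<bar>)"

end

theory Submission imports Defs "HOL-Analysis.Analysis" begin

text \<open>
Write \<open>f x = ln \<bar>2 sin (\<pi> x)\<bar>\<close>, so that \<open>ln P\<^sub>N\<close> is the Birkhoff sum of \<open>f\<close> over \<open>\<alpha>, \<dots>, N \<alpha>\<close>, and
formally \<open>f x = - (\<Sum>m\<ge>1. cos (2 \<pi> m x) / m)\<close>. The proof makes this series absolutely convergent by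
replacing \<open>f x\<close> with \<open>ln \<bar>1 - r e(x)\<bar>\<close>, where \<open>e(x) = exp (2 \<pi> i x)\<close>, \<open>r = \<rho>\<^sup>2\<close>, \<open>\<rho> = 1 - 1/R\<close>, and
\<open>R = M / K\<close> for a constant \<open>K \<ge> 1\<close>. Summing the cosines over \<open>n \<le> N\<close> with the Dirichlet kernel turns
\<open>ln P\<^sub>N\<close> into
\<open>1/2 (\<Sum>m. r^m / m) - Y (N + 1/2) + error\<close>, with
\<open>Y t = (\<Sum>m. r^m / (2 m sin (\<pi> m \<alpha>)) sin (2 \<pi> m \<alpha> t))\<close>.
The first sum is \<open>1/2 ln R + O(1)\<close>, which is the main term, and \<open>Y\<close> carries all the fluctuation.

The only arithmetic input for the upper bounds is \<open>(\<Sum>j\<le>n. 1 / sin\<^sup>2 (\<pi> j \<alpha>)) \<le> C n\<^sup>2\<close> (\<open>sum_csc_sq_le\<close>),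
which holds because the points \<open>j \<alpha>\<close> with \<open>j \<le> n\<close> are \<open>c/n\<close>-separated modulo one and stay \<open>c/n\<close> away
from zero. It is used in four ways. It bounds the smoothing error, uniformly for \<open>N \<le> M\<close>, by
\<open>O(K\<^sup>2)\<close> (\<open>ln_sudler_approx\<close>). Since averaging \<open>sin ((2N+1) \<pi> m \<alpha>)\<close> over \<open>N\<close> gains another factor
\<open>1 / sin (\<pi> m \<alpha>)\<close>, it bounds the mean of \<open>Y\<close> by \<open>O(1)\<close> (\<open>abs_sum_oscillation_le\<close>), so the mean of
\<open>ln P\<^sub>N\<close> is even \<open>1/2 ln M + O(1)\<close>. It bounds the diagonal part \<open>D = (\<Sum>m. r^(2m) / (4 m\<^sup>2 sin\<^sup>2 (\<pi> m \<alpha>)))\<close>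
of the second moment by \<open>O(ln R)\<close> (\<open>energy_le\<close>). Finally it controls the off-diagonal part: with Fejer weights of
length \<open>L\<close> the second moment of \<open>Y\<close> equals \<open>1/2 L\<^sup>2 D + O(R\<^sup>2 (1 + ln R))\<close> (\<open>second_moment\<close>).

For the upper bound of the variance \<open>K = 1\<close> is enough. For the lower bound, Dirichlet's theorem
provides in every geometric block an \<open>m\<close> with \<open>m \<parallel>m \<alpha>\<parallel> \<le> 1\<close>, whence \<open>D \<ge> \<kappa> ln R - O(1)\<close>
(\<open>energy_ge\<close>); as \<open>L\<close> has order \<open>M = K R\<close>, a large constant \<open>K\<close> makes the off-diagonal error a small
fraction of \<open>1/2 L\<^sup>2 D\<close>. The finitely many small \<open>M\<close> only need the variance to be nonzero, and it can
only vanish if \<open>P\<^sub>1 = P\<^sub>2\<close>, which forces \<open>\<alpha>\<close> to be rational.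
\<close>

section \<open>Trigonometric sums\<close>

lemma two_sin_sum_cos:
  fixes x :: real
  shows "2 * sin x * (\<Sum>n=1..N. cos (2 * real n * x)) = sin ((2 * real N + 1) * x) - sin x"
proof (induction N)
  case (Suc N)
  have "2 * sin x * cos (2 * real (Suc N) * x)
      = sin ((2 * real (Suc N) + 1) * x) - sin ((2 * real N + 1) * x)"
    using sin_times_cos[of x "2 * real (Suc N) * x"] sin_minus[of "x - 2 * real (Suc N) * x"]
    by (simp add: algebra_simps)
  then show ?case using Suc by (simp add: distrib_left)
qed simp

lemma two_sin_sum_sin_odd:
  fixes x :: real
  shows "2 * sin x * (\<Sum>N=1..M. sin ((2 * real N + 1) * x)) = cos (2 * x) - cos (2 * (real M + 1) * x)"
proof (induction M)
  case (Suc M)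
  have "2 * sin x * sin ((2 * real (Suc M) + 1) * x)
      = cos (2 * (real M + 1) * x) - cos (2 * (real (Suc M) + 1) * x)"
    using sin_times_sin[of x "(2 * real (Suc M) + 1) * x"]
      cos_minus[of "x - (2 * real (Suc M) + 1) * x"]
    by (simp add: algebra_simps)
  then show ?case using Suc by (simp add: distrib_left)
qed simp

lemma sum_sin_odd_le:
  fixes x :: real
  assumes "sin x \<noteq> 0"
  shows "\<bar>\<Sum>N=1..M. sin ((2 * real N + 1) * x)\<bar> \<le> 1 / \<bar>sin x\<bar>"
proof -
  let ?S = "\<Sum>N=1..M. sin ((2 * real N + 1) * x)"
  have "2 * (\<bar>sin x\<bar> * \<bar>?S\<bar>) = \<bar>cos (2 * x) - cos (2 * (real M + 1) * x)\<bar>"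
    unfolding two_sin_sum_sin_odd[symmetric] by (simp add: abs_mult)
  also have "\<dots> \<le> 2"
    using abs_triangle_ineq4[of "cos (2 * x)" "cos (2 * (real M + 1) * x)"]
      abs_cos_le_one[of "2 * x"] abs_cos_le_one[of "2 * (real M + 1) * x"] by linarith
  finally show ?thesis using assms by (simp add: field_simps)
qed

lemma sin_sum_cos_shift:
  fixes x t :: real
  shows "sin x * (\<Sum>i<L. cos (2 * (t + real i) * x)) = sin (real L * x) * cos ((2 * t + real L - 1) * x)"
proof (induction L)
  case (Suc L)
  have "2 * (sin (real (Suc L) * x) * cos ((2 * t + real (Suc L) - 1) * x))
      - 2 * (sin (real L * x) * cos ((2 * t + real L - 1) * x)) = 2 * (sin x * cos (2 * (t + real L) * x))"
    using sin_times_cos[of "real (Suc L) * x" "(2 * t + real (Suc L) - 1) * x"]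
      sin_times_cos[of "real L * x" "(2 * t + real L - 1) * x"]
      sin_times_cos[of x "2 * (t + real L) * x"]
      sin_minus[of "x - 2 * t * x"] sin_minus[of "x - 2 * (t + real L) * x"]
    by (simp add: algebra_simps)
  then show ?case using Suc by (simp add: distrib_left)
qed simp

text \<open>A double sum over \<open>i\<close> and \<open>k\<close> gives each shift \<open>d = i - k\<close> the triangular weight \<open>L - \<bar>d\<bar>\<close>. Unlike
sharp cutoffs, whose kernel decays only like \<open>1 / \<bar>sin x\<bar>\<close>, this average has a kernel of size
\<open>1 / sin\<^sup>2 x\<close>, which is small enough to sum absolutely over all pairs of frequencies.\<close>

definition fejer :: "nat \<Rightarrow> real \<Rightarrow> real \<Rightarrow> real" where
  "fejer L t x = (\<Sum>i<L. \<Sum>k<L. cos (2 * (t + real i - real k) * x))"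

lemma fejer_0: "fejer L t 0 = (real L)\<^sup>2"
  by (simp add: fejer_def power2_eq_square)

lemma fejer_minus: "fejer L t (- x) = fejer L t x"
  by (simp add: fejer_def)

text \<open>Both the sum over \<open>i\<close> and the sum over \<open>k\<close> are arithmetic progressions of angles, each of which
contributes one factor \<open>sin (L x) / sin x\<close> and a shift of the centre by \<open>(L - 1) / 2\<close>; the two shifts
cancel.\<close>

lemma fejer_sum:
  fixes x t :: real
  shows "(sin x)\<^sup>2 * fejer L t x
     = (sin (real L * x))\<^sup>2 * cos (2 * t * x)"
proof -
  have inner: "sin x * (\<Sum>k<L. cos (2 * (s - real k) * x))
      = sin (real L * x) * cos (2 * (s - (real L - 1) / 2) * x)" for s
  proof -
    have "cos (2 * (s - real k) * x) = cos (2 * (- s + real k) * x)" for k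
    proof -
      have "2 * (- s + real k) * x = - (2 * (s - real k) * x)" by (simp add: algebra_simps)
      then show ?thesis by (simp only: cos_minus)
    qed
    then have "sin x * (\<Sum>k<L. cos (2 * (s - real k) * x))
       = sin (real L * x) * cos ((2 * (- s) + real L - 1) * x)"
      by (simp only: sin_sum_cos_shift)
    also have "(2 * (- s) + real L - 1) * x = - (2 * (s - (real L - 1) / 2) * x)"
      by (simp add: field_simps)
    finally show ?thesis by simp
  qed
  have "(sin x)\<^sup>2 * (\<Sum>i<L. \<Sum>k<L. cos (2 * (t + real i - real k) * x))
      = sin x * (\<Sum>i<L. sin x * (\<Sum>k<L. cos (2 * (t + real i - real k) * x)))"
    by (simp add: power2_eq_square sum_distrib_left mult.assoc)
  also have "\<dots> = sin x * (\<Sum>i<L. sin (real L * x) * cos (2 * ((t - (real L - 1) / 2) + real i) * x))"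
    by (subst inner) (simp add: algebra_simps)
  also have "\<dots> = sin (real L * x) * (sin x * (\<Sum>i<L. cos (2 * ((t - (real L - 1) / 2) + real i) * x)))"
    by (simp add: sum_distrib_left mult.left_commute)
  also have "\<dots> = sin (real L * x) * (sin (real L * x) * cos ((2 * (t - (real L - 1) / 2) + real L - 1) * x))"
    by (simp only: sin_sum_cos_shift)
  also have "(2 * (t - (real L - 1) / 2) + real L - 1) * x = 2 * t * x"
    by (simp add: field_simps)
  finally show ?thesis by (simp add: fejer_def power2_eq_square mult.assoc)
qed

lemma abs_fejer_sum_le:
  fixes x t :: real
  assumes "sin x \<noteq> 0"
  shows "\<bar>fejer L t x\<bar> \<le> 1 / (sin x)\<^sup>2"
proof -
  have "(sin x)\<^sup>2 * \<bar>fejer L t x\<bar>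
     = \<bar>(sin (real L * x))\<^sup>2 * cos (2 * t * x)\<bar>"
    unfolding fejer_sum[symmetric] by (simp add: abs_mult)
  also have "\<dots> \<le> 1 * 1"
    unfolding abs_mult by (intro mult_mono) (auto simp: abs_square_le_1)
  finally show ?thesis using assms by (simp add: field_simps)
qed

lemma abs_sin_pi_diff_int: "\<bar>sin (pi * (x - of_int k))\<bar> = \<bar>sin (pi * x)\<bar>"
proof -
  have s: "sin (pi * of_int k) = 0" by (simp add: sin_zero_iff_int2 mult.commute)
  then have c: "\<bar>cos (pi * of_int k)\<bar> = 1"
    using sin_cos_squared_add[of "pi * of_int k"] by (simp add: power2_eq_1_iff)
  have "sin (pi * (x - of_int k)) = sin (pi * x) * cos (pi * of_int k)"
    using s by (simp add: right_diff_distrib sin_diff)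
  then show ?thesis using c by (simp add: abs_mult)
qed

text \<open>The half-angle formula reduces \<open>sin y \<ge> y / 2\<close> on \<open>[0, \<pi>/2]\<close> to \<open>sin z \<ge> z cos z\<close> at \<open>z = y / 2\<close>, where
\<open>cos\<^sup>2 z \<ge> 1/2\<close>.\<close>

lemma abs_sin_pi_ge_dist:
  "\<bar>sin (pi * x)\<bar> \<ge> dist_nearest_int x"
proof -
  have tan_bound: "y * cos y \<le> sin y" if "0 \<le> y" "y \<le> pi" for y :: real
  proof -
    have "(\<lambda>y. sin y - y * cos y) 0 \<le> (\<lambda>y. sin y - y * cos y) y"
    proof (rule DERIV_nonneg_imp_nondecreasing[OF that(1)])
      fix z assume z: "0 \<le> z" "z \<le> y"
      have "((\<lambda>y. sin y - y * cos y) has_real_derivative z * sin z) (at z)"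
        by (auto intro!: derivative_eq_intros)
      moreover have "z * sin z \<ge> 0" using z that by (simp add: sin_ge_zero)
      ultimately show "\<exists>d. ((\<lambda>y. sin y - y * cos y) has_real_derivative d) (at z) \<and> 0 \<le> d" by blast
    qed
    then show ?thesis by simp
  qed
  have half: "y / 2 \<le> sin y" if "0 \<le> y" "y \<le> pi / 2" for y :: real
  proof -
    have c: "(cos (y / 2))\<^sup>2 \<ge> 1 / 2"
      using cos_double_cos[of "y / 2"] cos_ge_zero[of y] that by simp
    have "y / 2 \<le> y * (cos (y / 2))\<^sup>2" using mult_left_mono[OF c that(1)] by simp
    also have "\<dots> = 2 * (y / 2 * cos (y / 2)) * cos (y / 2)" by (simp add: power2_eq_square)
    also have "\<dots> \<le> 2 * sin (y / 2) * cos (y / 2)"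
      by (intro mult_right_mono mult_left_mono tan_bound cos_ge_zero) (use that pi_gt_zero in auto)
    also have "\<dots> = sin y" using sin_double[of "y / 2"] by simp
    finally show ?thesis .
  qed
  define d where "d = x - of_int (round x)"
  have d: "\<bar>d\<bar> \<le> 1 / 2" using of_int_round_abs_le[of x] by (simp add: d_def abs_minus_commute)
  have "\<bar>sin (pi * x)\<bar> = \<bar>sin (pi * d)\<bar>"
    unfolding d_def by (rule abs_sin_pi_diff_int[symmetric])
  also have "\<dots> = \<bar>sin (pi * \<bar>d\<bar>)\<bar>" by (cases "d \<ge> 0") auto
  finally have eq: "\<bar>sin (pi * x)\<bar> = \<bar>sin (pi * \<bar>d\<bar>)\<bar>" .
  have "\<bar>d\<bar> * 1 \<le> \<bar>d\<bar> * (pi / 2)" using pi_ge_two by (intro mult_left_mono) auto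
  also have "\<dots> = pi * \<bar>d\<bar> / 2" by simp
  also have "\<dots> \<le> sin (pi * \<bar>d\<bar>)" using d by (intro half) (auto simp: mult_le_cancel_left)
  finally show ?thesis unfolding eq dist_nearest_int_def d_def[symmetric] by simp
qed

lemma abs_sin_pi_le_dist:
  "\<bar>sin (pi * x)\<bar> \<le> pi * \<bar>x - of_int k\<bar>"
proof -
  have "\<bar>sin (pi * x)\<bar> = \<bar>sin (pi * (x - of_int k))\<bar>"
    by (rule abs_sin_pi_diff_int[symmetric])
  also have "\<dots> \<le> \<bar>pi * (x - of_int k)\<bar>" by (rule abs_sin_x_le_abs_x)
  finally show ?thesis by (simp add: abs_mult)
qed

section \<open>Weighted sums\<close>

lemma sum_swap4:
  "(\<Sum>i\<in>I. \<Sum>k\<in>K. \<Sum>m\<in>M. \<Sum>n\<in>N. (G i k m n :: real)) = (\<Sum>m\<in>M. \<Sum>n\<in>N. \<Sum>i\<in>I. \<Sum>k\<in>K. G i k m n)"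
proof -
  have "(\<Sum>i\<in>I. \<Sum>k\<in>K. \<Sum>m\<in>M. \<Sum>n\<in>N. G i k m n) = (\<Sum>i\<in>I. \<Sum>m\<in>M. \<Sum>k\<in>K. \<Sum>n\<in>N. G i k m n)"
    by (intro sum.cong refl sum.swap)
  also have "\<dots> = (\<Sum>m\<in>M. \<Sum>i\<in>I. \<Sum>k\<in>K. \<Sum>n\<in>N. G i k m n)" by (rule sum.swap)
  also have "\<dots> = (\<Sum>m\<in>M. \<Sum>i\<in>I. \<Sum>n\<in>N. \<Sum>k\<in>K. G i k m n)"
    by (intro sum.cong refl sum.swap)
  also have "\<dots> = (\<Sum>m\<in>M. \<Sum>n\<in>N. \<Sum>i\<in>I. \<Sum>k\<in>K. G i k m n)"
    by (intro sum.cong refl sum.swap)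
  finally show ?thesis .
qed

text \<open>Abel summation: a decreasing nonnegative weight is a nonnegative combination of indicators of initial
segments, so a comparison of all partial sums carries over to the weighted sums.\<close>

lemma sum_decreasing_weight_mono:
  fixes w u v :: "nat \<Rightarrow> real"
  assumes partial: "\<And>n. (\<Sum>j=1..n. u j) \<le> (\<Sum>j=1..n. v j)"
    and w: "\<And>j. 0 \<le> w j" "\<And>j. 1 \<le> j \<Longrightarrow> w (Suc j) \<le> w j"
  shows "(\<Sum>j=1..n. w j * u j) \<le> (\<Sum>j=1..n. w j * v j)"
proof -
  define D where "D n = (\<Sum>j=1..n. v j - u j)" for n
  have D: "D n \<ge> 0" for n unfolding D_def sum_subtractf using partial[of n] by simp
  have "(\<Sum>j=1..n. w j * (v j - u j)) \<ge> w n * D n"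
  proof (induction n)
    case (Suc n)
    show ?case
    proof (cases n)
      case 0
      then show ?thesis by (simp add: D_def)
    next
      case (Suc k)
      have "w (Suc n) * D n \<le> w n * D n" using w(2)[of n] D[of n] Suc by (intro mult_right_mono) auto
      with \<open>w n * D n \<le> (\<Sum>j=1..n. w j * (v j - u j))\<close> show ?thesis
        by (simp add: D_def algebra_simps)
    qed
  qed (simp add: D_def)
  then have "(\<Sum>j=1..n. w j * (v j - u j)) \<ge> 0" using D[of n] w(1)[of n] by (smt (verit) mult_nonneg_nonneg)
  then show ?thesis by (simp add: right_diff_distrib sum_subtractf)
qed

lemma sum_odd_numbers: "(\<Sum>j=1..n. 2 * real j - 1) = (real n)\<^sup>2"
  by (induction n) (auto simp: power2_eq_square algebra_simps)

lemma sum_power_le: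
  fixes x :: real
  assumes "0 \<le> x" "x < 1"
  shows "(\<Sum>j=1..n. x ^ j) \<le> 1 / (1 - x)"
proof -
  have "(\<Sum>j=1..n. x ^ j) \<le> (\<Sum>j. x ^ j)"
    by (intro sum_le_suminf) (use assms in auto)
  then show ?thesis using suminf_geometric[of x] assms by simp
qed

lemma sum_nat_power_le:
  fixes x :: real
  assumes "0 \<le> x" "x < 1"
  shows "(\<Sum>j=1..n. real j * x ^ j) \<le> 1 / (1 - x)\<^sup>2"
proof -
  have s: "(\<lambda>j. real (Suc j) * x ^ j) sums (1 / (1 - x)\<^sup>2)"
    using geometric_deriv_sums[of x] assms by simp
  have "(\<Sum>j=1..n. real j * x ^ j) \<le> (\<Sum>j\<in>{1..n}. real (Suc j) * x ^ j)"
    using assms by (intro sum_mono mult_right_mono) auto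
  also have "\<dots> \<le> (\<Sum>j. real (Suc j) * x ^ j)"
    by (intro sum_le_suminf) (use s assms in \<open>auto simp: sums_iff\<close>)
  finally show ?thesis using s by (simp add: sums_iff)
qed

lemma power_over_nat_sums:
  fixes x :: real
  assumes "\<bar>x\<bar> < 1"
  shows "(\<lambda>j. x ^ j / real j) sums (- ln (1 - x))"
  using sums_minus[OF ln_series'[of "- x"]] assms by simp

lemma sum_power_over_nat_le:
  fixes x :: real
  assumes "0 \<le> x" "x < 1"
  shows "(\<Sum>j=1..n. x ^ j / real j) \<le> - ln (1 - x)"
proof -
  have s: "(\<lambda>j. x ^ j / real j) sums (- ln (1 - x))" using power_over_nat_sums assms by simp
  have "(\<Sum>j=1..n. x ^ j / real j) \<le> (\<Sum>j. x ^ j / real j)"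
    by (intro sum_le_suminf) (use s assms in \<open>auto simp: sums_iff\<close>)
  then show ?thesis using s by (simp add: sums_iff)
qed

section \<open>Cosecant growth along a badly approximable rotation\<close>

lemma badly_approximable_lower:
  assumes "badly_approximable \<alpha>"
  obtains c where "c > 0" "\<And>q::nat. q \<ge> 1 \<Longrightarrow> c \<le> real q * dist_nearest_int (real q * \<alpha>)"
proof -
  let ?f = "\<lambda>q::nat. real q * dist_nearest_int (real q * \<alpha>)"
  have "bdd_below (?f ` {1..})" by (rule bdd_belowI2[of _ 0]) (simp add: dist_nearest_int_def)
  then have "(INF q\<in>{1..}. ?f q) \<le> ?f q" if "q \<ge> 1" for q
    using that by (intro cINF_lower) auto
  with assms that show ?thesis unfolding badly_approximable_def by blast
qed

lemma sum_inverse_squares_le: "n \<ge> 1 \<Longrightarrow> (\<Sum>k=1..n. 1 / (real k)\<^sup>2) \<le> 2 - 1 / real n"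
proof (induction n rule: dec_induct)
  case (step n)
  have "1 / (real (Suc n))\<^sup>2 \<le> 1 / (real n * real (Suc n))"
    using step by (intro divide_left_mono) (auto simp: power2_eq_square)
  also have "\<dots> = 1 / real n - 1 / real (Suc n)" using step by (simp add: field_simps)
  finally show ?case using step by simp
qed simp

text \<open>Only some bound independent of \<open>S\<close> matters; it will be applied to the set of cells that are hit by the
points of a rotation.\<close>

lemma sum_inverse_squares_int_le:
  assumes "finite S" "(0::int) \<notin> S"
  shows "(\<Sum>k\<in>S. 1 / (real_of_int k)\<^sup>2) \<le> 4"
proof -
  obtain m :: nat where m: "\<And>k. k \<in> S \<Longrightarrow> nat \<bar>k\<bar> \<le> m" "m \<ge> 1"
  proof
    show "nat \<bar>k\<bar> \<le> Suc (\<Sum>k\<in>S. nat \<bar>k\<bar>)" if "k \<in> S" for k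
      using member_le_sum[OF that, of "\<lambda>k. nat \<bar>k\<bar>"] assms by simp
  qed simp
  have "S \<subseteq> int ` {1..m} \<union> (\<lambda>k. - int k) ` {1..m}"
  proof
    fix k assume k: "k \<in> S"
    then have "k \<noteq> 0" using assms by auto
    then show "k \<in> int ` {1..m} \<union> (\<lambda>k. - int k) ` {1..m}"
      using m(1)[OF k] by (cases "k > 0") (auto intro!: image_eqI[of _ _ "nat \<bar>k\<bar>"])
  qed
  then have "(\<Sum>k\<in>S. 1 / (real_of_int k)\<^sup>2)
      \<le> (\<Sum>k\<in>int ` {1..m} \<union> (\<lambda>k. - int k) ` {1..m}. 1 / (real_of_int k)\<^sup>2)"
    by (intro sum_mono2) auto
  also have "\<dots> = (\<Sum>k\<in>int ` {1..m}. 1 / (real_of_int k)\<^sup>2) + (\<Sum>k\<in>(\<lambda>k. - int k) ` {1..m}. 1 / (real_of_int k)\<^sup>2)"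
    by (intro sum.union_disjoint) auto
  also have "\<dots> = 2 * (\<Sum>k=1..m. 1 / (real k)\<^sup>2)"
    by (subst (1 2) sum.reindex) (auto simp: inj_on_def)
  also have "\<dots> \<le> 4" using sum_inverse_squares_le[OF m(2)] m(2) by (smt (verit) divide_nonneg_nonneg of_nat_0_le_iff)
  finally show ?thesis .
qed

definition csc_sq :: "real \<Rightarrow> nat \<Rightarrow> real" where
  "csc_sq \<alpha> j = 1 / (sin (pi * real j * \<alpha>))\<^sup>2"

lemma csc_sq_nonneg [simp]: "0 \<le> csc_sq \<alpha> j"
  by (simp add: csc_sq_def)

lemma dist_nearest_int_le: "dist_nearest_int x \<le> \<bar>x - of_int k\<bar>"
  unfolding dist_nearest_int_def by (rule round_diff_minimal)

text \<open>Cut the circle into cells of length \<open>c/n\<close>, where cell \<open>k\<close> contains the signed residues between \<open>k c/n\<close>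
and \<open>(k+1) c/n\<close>. Two points \<open>i \<alpha>\<close> and \<open>j \<alpha>\<close> with \<open>i < j \<le> n\<close> are at distance \<open>\<parallel>(j-i) \<alpha>\<parallel> \<ge> c/n\<close>, so
each cell contains at most one point, and a point in cell \<open>k\<close> contributes \<open>O(n\<^sup>2 / (c k)\<^sup>2)\<close>.\<close>

lemma sum_csc_sq_le:
  assumes c: "c > 0" "\<And>q::nat. q \<ge> 1 \<Longrightarrow> c \<le> real q * dist_nearest_int (real q * \<alpha>)"
  shows "(\<Sum>j=1..n. csc_sq \<alpha> j) \<le> 16 / c\<^sup>2 * (real n)\<^sup>2"
proof -
  define x where "x j = real j * \<alpha> - of_int (round (real j * \<alpha>))" for j :: nat
  have dist_x: "dist_nearest_int (real j * \<alpha>) = \<bar>x j\<bar>" for j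
    by (simp add: x_def dist_nearest_int_def)
  have lower: "c / real n \<le> dist_nearest_int (real j * \<alpha>)" if "j \<in> {1..n}" for j
  proof -
    have "c / real n \<le> c / real j" using that c(1) by (intro divide_left_mono) auto
    also have "\<dots> \<le> dist_nearest_int (real j * \<alpha>)" using c(2)[of j] that by (simp add: field_simps)
    finally show ?thesis .
  qed
  define y where "y j = x j * real n / c" for j
  define K where "K j = \<lfloor>y j\<rfloor>" for j
  have abs_y: "\<bar>y j\<bar> \<ge> 1" if "j \<in> {1..n}" for j
    using lower[OF that, unfolded dist_x] that c(1) by (simp add: y_def abs_mult field_simps)
  have inj: "inj_on K {1..n}"
  proof (rule linorder_inj_onI)
    fix i j assume ij: "i < j" "i \<in> {1..n}" "j \<in> {1..n}"
    have "c / real n \<le> dist_nearest_int (real (j - i) * \<alpha>)" using ij by (intro lower) auto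
    also have "\<dots> \<le> \<bar>real (j - i) * \<alpha> - of_int (round (real j * \<alpha>) - round (real i * \<alpha>))\<bar>"
      by (rule dist_nearest_int_le)
    also have "real (j - i) * \<alpha> - of_int (round (real j * \<alpha>) - round (real i * \<alpha>)) = x j - x i"
      using ij by (simp add: x_def algebra_simps of_nat_diff)
    finally have "1 \<le> \<bar>x j - x i\<bar> * real n / c" using ij c(1) by (simp add: field_simps)
    also have "\<dots> = \<bar>y j - y i\<bar>"
      using c(1) by (simp add: y_def abs_mult flip: diff_divide_distrib left_diff_distrib)
    finally show "K i \<noteq> K j" unfolding K_def by linarith
  qed auto
  have bound: "csc_sq \<alpha> j \<le> 4 * (real n / c)\<^sup>2 * (1 / (real_of_int (K j))\<^sup>2)" if j: "j \<in> {1..n}" for j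
  proof -
    have x0: "x j \<noteq> 0" using abs_y[OF j] by (auto simp: y_def)
    have "\<bar>x j\<bar> \<le> \<bar>sin (pi * real j * \<alpha>)\<bar>"
      using abs_sin_pi_ge_dist[of "real j * \<alpha>"] by (simp add: dist_x mult.assoc)
    then have "csc_sq \<alpha> j \<le> 1 / (x j)\<^sup>2" unfolding csc_sq_def using x0
      by (intro frac_le) (auto simp: abs_le_square_iff)
    also have "\<dots> = (real n / c)\<^sup>2 * (1 / (y j)\<^sup>2)"
      using j c(1) x0 by (simp add: y_def power_mult_distrib power_divide)
    also have "\<dots> \<le> (real n / c)\<^sup>2 * (4 * (1 / (real_of_int (K j))\<^sup>2))"
    proof (intro mult_left_mono)
      have K0: "K j \<noteq> 0" using abs_y[OF j] unfolding K_def by linarith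
      \<comment> \<open>For negative \<open>y j\<close> the floor exceeds \<open>y j\<close> in absolute value by less than \<open>1 \<le> \<bar>y j\<bar>\<close>.\<close>
      have "\<bar>real_of_int (K j)\<bar> \<le> \<bar>2 * y j\<bar>" using abs_y[OF j] unfolding K_def by linarith
      then have "(real_of_int (K j))\<^sup>2 \<le> 4 * (y j)\<^sup>2" by (simp add: abs_le_square_iff power_mult_distrib)
      moreover have "(y j)\<^sup>2 > 0" "(real_of_int (K j))\<^sup>2 > 0" using abs_y[OF j] K0 by auto
      ultimately show "1 / (y j)\<^sup>2 \<le> 4 * (1 / (real_of_int (K j))\<^sup>2)" by (simp add: field_simps)
    qed simp
    finally show ?thesis by (simp add: mult_ac)
  qed
  have "(\<Sum>j=1..n. csc_sq \<alpha> j) \<le> (\<Sum>j=1..n. 4 * (real n / c)\<^sup>2 * (1 / (real_of_int (K j))\<^sup>2))"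
    by (intro sum_mono bound)
  also have "\<dots> = 4 * (real n / c)\<^sup>2 * (\<Sum>k\<in>K ` {1..n}. 1 / (real_of_int k)\<^sup>2)"
    unfolding sum.reindex[OF inj] by (simp add: sum_distrib_left)
  also have "\<dots> \<le> 4 * (real n / c)\<^sup>2 * 4"
  proof (intro mult_left_mono sum_inverse_squares_int_le)
    show "0 \<notin> K ` {1..n}"
    proof
      assume "0 \<in> K ` {1..n}"
      then obtain j where "j \<in> {1..n}" "K j = 0" by auto
      then show False using abs_y[of j] unfolding K_def by linarith
    qed
  qed auto
  finally show ?thesis by (simp add: power_divide)
qed

text \<open>Dirichlet's theorem at level \<open>B^k\<close> gives \<open>m \<le> B^k\<close> with \<open>\<parallel>m \<alpha>\<parallel> < B^(-k)\<close>, so \<open>m \<parallel>m \<alpha>\<parallel> \<le> 1\<close>; bad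
approximability forces \<open>m > c B^k \<ge> B^(k-1)\<close>. Hence each of the roughly \<open>ln R / ln B\<close> blocks
\<open>(B^(k-1), B^k]\<close> below \<open>R\<close> contributes at least \<open>1 / \<pi>\<^sup>2\<close>.\<close>

lemma sum_csc_sq_over_square_ge:
  assumes c: "0 < c" "c \<le> 1/2" "\<And>q::nat. q \<ge> 1 \<Longrightarrow> c \<le> real q * dist_nearest_int (real q * \<alpha>)"
    and R: "R \<ge> 1" and X: "R \<le> real X"
  shows "(\<Sum>m\<in>{m\<in>{1..X}. real m \<le> R}. csc_sq \<alpha> m / (real m)\<^sup>2)
      \<ge> (ln R / ln (2 / c) - 1) / pi\<^sup>2"
proof -
  define B where "B = nat \<lceil>1 / c\<rceil>"
  have B: "1 / c \<le> real B" "real B \<le> 2 / c" "B \<ge> 2" 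
  proof -
    have c': "1 / c \<ge> 2" using c by (simp add: field_simps)
    show "1 / c \<le> real B" unfolding B_def by linarith
    then show "B \<ge> 2" using c' by linarith
    show "real B \<le> 2 / c" using c' unfolding B_def by linarith
  qed
  define n where "n = nat \<lfloor>ln R / ln (real B)\<rfloor>"
  have lnB: "ln (real B) > 0" using B by simp
  have "real n \<le> ln R / ln (real B)" unfolding n_def using R lnB by simp
  then have "real n * ln (real B) \<le> ln R" using lnB by (simp add: field_simps)
  then have "ln (real B ^ n) \<le> ln R" using B by (simp add: ln_realpow)
  then have Bn: "real B ^ n \<le> R" using B R by (simp add: ln_le_cancel_iff)
  have "\<exists>m. real B ^ (k - 1) < real m \<and> m \<le> B ^ k \<and> real m * \<bar>sin (pi * real m * \<alpha>)\<bar> \<le> pi" if k: "k \<ge> 1" for k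
  proof -
    have "B ^ k > 0" using B by simp
    then obtain h q where q: "0 < q" "q \<le> int (B ^ k)" "\<bar>of_int q * \<alpha> - of_int h\<bar> < 1 / real (B ^ k)"
      by (rule Dirichlet_approx)
    define m where "m = nat q"
    have m: "0 < m" "m \<le> B ^ k" "real_of_int q = real m" 
      using q unfolding m_def by (simp_all add: nat_le_iff)
    have close: "\<bar>real m * \<alpha> - of_int h\<bar> < 1 / real (B ^ k)" using q m by simp
    have "c \<le> real m * dist_nearest_int (real m * \<alpha>)" using c(3)[of m] m by simp
    also have "\<dots> \<le> real m * \<bar>real m * \<alpha> - of_int h\<bar>" by (intro mult_left_mono dist_nearest_int_le) simp
    also have "\<dots> < real m * (1 / real (B ^ k))" using m close by (intro mult_strict_left_mono) auto
    finally have "c * real B ^ k < real m" using B by (simp add: field_simps)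
    moreover have "real B ^ (k - 1) \<le> c * real B ^ k"
    proof -
      have "real B ^ (k - 1) * 1 \<le> real B ^ (k - 1) * (c * real B)"
        using B(1) c(1) by (intro mult_left_mono) (auto simp: field_simps)
      also have "\<dots> = c * real B ^ k" using k by (cases k) auto
      finally show ?thesis by simp
    qed
    moreover have "real m * \<bar>sin (pi * real m * \<alpha>)\<bar> \<le> pi"
    proof -
      have "real m * \<bar>sin (pi * real m * \<alpha>)\<bar> \<le> real (B ^ k) * (pi * (1 / real (B ^ k)))"
      proof (intro mult_mono)
        have "\<bar>sin (pi * real m * \<alpha>)\<bar> \<le> pi * \<bar>real m * \<alpha> - of_int h\<bar>"
          using abs_sin_pi_le_dist[of "real m * \<alpha>" h] by (simp add: mult.assoc)
        also have "\<dots> \<le> pi * (1 / real (B ^ k))" using close by (intro mult_left_mono) auto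
        finally show "\<bar>sin (pi * real m * \<alpha>)\<bar> \<le> pi * (1 / real (B ^ k))" .
      qed (use m in \<open>auto simp del: of_nat_power\<close>)
      then show ?thesis using B by simp
    qed
    ultimately have "real B ^ (k - 1) < real m" "real m * \<bar>sin (pi * real m * \<alpha>)\<bar> \<le> pi" by linarith+
    then show ?thesis using m by blast
  qed
  then obtain f where f: "\<And>k. k \<ge> 1 \<Longrightarrow> real B ^ (k - 1) < real (f k)"
    "\<And>k. k \<ge> 1 \<Longrightarrow> f k \<le> B ^ k"
    "\<And>k. k \<ge> 1 \<Longrightarrow> real (f k) * \<bar>sin (pi * real (f k) * \<alpha>)\<bar> \<le> pi"
    by metis
  have inj: "inj_on f {1..n}"
  proof (rule linorder_inj_onI)
    fix i j assume ij: "i < j" "i \<in> {1..n}" "j \<in> {1..n}"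
    have "real (f i) \<le> real (B ^ i)" using f(2)[of i] ij by (simp del: of_nat_power)
    also have "\<dots> \<le> real B ^ (j - 1)" using ij B by (simp add: power_increasing)
    also have "\<dots> < real (f j)" using f(1)[of j] ij by simp
    finally show "f i \<noteq> f j" by auto
  qed auto
  have sub: "f ` {1..n} \<subseteq> {m\<in>{1..X}. real m \<le> R}"
  proof safe
    fix k assume k: "k \<in> {1..n}"
    have "real (f k) > 0" using f(1)[of k] k B by (smt (verit) atLeastAtMost_iff of_nat_0_le_iff zero_le_power)
    moreover have "real (f k) \<le> real (B ^ k)" using f(2)[of k] k by (simp del: of_nat_power)
    moreover have "real (B ^ k) \<le> real B ^ n" using k B by (simp add: power_increasing)
    ultimately have "real (f k) > 0" "real (f k) \<le> R" "real (f k) \<le> real X" using Bn X by linarith+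
    then show "real (f k) \<le> R" "f k \<in> {1..X}" by auto
  qed
  have large: "csc_sq \<alpha> (f k) / (real (f k))\<^sup>2 \<ge> 1 / pi\<^sup>2" if k: "k \<in> {1..n}" for k
  proof -
    have p: "f k \<ge> 1" using imageI[OF k, of f] sub by auto
    have "0 < dist_nearest_int (real (f k) * \<alpha>)" using c(3)[OF p] c(1) p by (smt (verit) mult_nonneg_nonpos of_nat_0_le_iff)
    then have s: "\<bar>sin (pi * real (f k) * \<alpha>)\<bar> > 0"
      using abs_sin_pi_ge_dist[of "real (f k) * \<alpha>"] by (simp add: mult.assoc)
    have "1 / pi\<^sup>2 \<le> 1 / (real (f k) * \<bar>sin (pi * real (f k) * \<alpha>)\<bar>)\<^sup>2"
      using f(3)[of k] k p s by (intro divide_left_mono power_mono) auto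
    then show ?thesis by (simp add: csc_sq_def power_mult_distrib mult.commute)
  qed
  have "ln (real B) \<le> ln (2 / c)" using B by (intro ln_mono) auto
  then have "ln R / ln (2 / c) \<le> ln R / ln (real B)"
    using R lnB by (intro divide_left_mono mult_pos_pos) auto
  also have "\<dots> \<le> real n + 1" unfolding n_def using R lnB by (simp add: of_nat_nat)
  finally have "(ln R / ln (2 / c) - 1) / pi\<^sup>2 \<le> real n / pi\<^sup>2" by (intro divide_right_mono) auto
  also have "\<dots> = (\<Sum>k=1..n. 1 / pi\<^sup>2)" by simp
  also have "\<dots> \<le> (\<Sum>k=1..n. csc_sq \<alpha> (f k) / (real (f k))\<^sup>2)" by (intro sum_mono large)
  also have "\<dots> = (\<Sum>m\<in>f ` {1..n}. csc_sq \<alpha> m / (real m)\<^sup>2)" unfolding sum.reindex[OF inj] by simp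
  also have "\<dots> \<le> (\<Sum>m\<in>{m\<in>{1..X}. real m \<le> R}. csc_sq \<alpha> m / (real m)\<^sup>2)"
    using sub by (intro sum_mono2) auto
  finally show ?thesis .
qed

section \<open>The oscillating part and its second moment\<close>

text \<open>The upper bounds depend on \<open>\<alpha>\<close> only through this quadratic growth of the sums of \<open>1 / sin\<^sup>2\<close>.\<close>

locale csc_growth =
  fixes \<alpha> C :: real
  assumes sin_nonzero: "\<And>j::nat. j \<ge> 1 \<Longrightarrow> sin (pi * real j * \<alpha>) \<noteq> 0"
    and growth: "\<And>n. (\<Sum>j=1..n. csc_sq \<alpha> j) \<le> C * (real n)\<^sup>2"
begin

lemma C_ge_1: "C \<ge> 1"
proof -
  have "1 \<le> csc_sq \<alpha> 1"
    using sin_nonzero[of 1] by (simp add: csc_sq_def abs_square_le_1)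
  also have "\<dots> \<le> C" using growth[of 1] by simp
  finally show ?thesis .
qed

text \<open>The growth hypothesis says that \<open>csc_sq \<alpha> j\<close> is on average at most \<open>2 C j\<close>, and decreasing weights
do not see more than that.\<close>

lemma weighted_growth:
  fixes w :: "nat \<Rightarrow> real"
  assumes "\<And>j. 0 \<le> w j" "\<And>j. 1 \<le> j \<Longrightarrow> w (Suc j) \<le> w j"
  shows "(\<Sum>j=1..n. w j * csc_sq \<alpha> j) \<le> 2 * C * (\<Sum>j=1..n. w j * real j)"
proof -
  have "(\<Sum>j=1..n. w j * csc_sq \<alpha> j) \<le> (\<Sum>j=1..n. w j * (C * (2 * real j - 1)))"
  proof (rule sum_decreasing_weight_mono)
    show "(\<Sum>j=1..n. csc_sq \<alpha> j) \<le> (\<Sum>j=1..n. C * (2 * real j - 1))" for n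
      using growth[of n] by (simp only: sum_distrib_left[symmetric] sum_odd_numbers)
  qed (use assms in auto)
  also have "\<dots> \<le> (\<Sum>j=1..n. w j * (2 * C * real j))"
    using assms C_ge_1 by (intro sum_mono mult_left_mono) auto
  also have "\<dots> = 2 * C * (\<Sum>j=1..n. w j * real j)" by (simp add: sum_distrib_left mult_ac)
  finally show ?thesis .
qed

context
  fixes x :: real
  assumes x: "0 \<le> x" "x < 1"
begin

lemma sum_power_csc_sq_le: "(\<Sum>j=1..n. x ^ j * csc_sq \<alpha> j) \<le> 2 * C / (1 - x)\<^sup>2"
proof -
  have "(\<Sum>j=1..n. x ^ j * csc_sq \<alpha> j) \<le> 2 * C * (\<Sum>j=1..n. x ^ j * real j)"
    using x by (intro weighted_growth) (auto simp: mult_left_le_one_le)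
  also have "\<dots> \<le> 2 * C * (1 / (1 - x)\<^sup>2)"
    using sum_nat_power_le[OF x, of n] C_ge_1 by (intro mult_left_mono) (auto simp: mult.commute)
  finally show ?thesis by simp
qed

lemma sum_power_csc_sq_over_nat_le: "(\<Sum>j=1..n. x ^ j / real j * csc_sq \<alpha> j) \<le> 2 * C / (1 - x)"
proof -
  have "(\<Sum>j=1..n. x ^ j / real j * csc_sq \<alpha> j) \<le> 2 * C * (\<Sum>j=1..n. x ^ j / real j * real j)"
    using x by (intro weighted_growth) (auto intro!: frac_le simp: mult_left_le_one_le)
  also have "(\<Sum>j=1..n. x ^ j / real j * real j) = (\<Sum>j=1..n. x ^ j)" by (intro sum.cong) auto
  also have "2 * C * \<dots> \<le> 2 * C * (1 / (1 - x))"
    using sum_power_le[OF x, of n] C_ge_1 by (intro mult_left_mono) auto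
  finally show ?thesis by simp
qed

lemma sum_power_csc_sq_over_square_le:
  "(\<Sum>j=1..n. x ^ j / (real j)\<^sup>2 * csc_sq \<alpha> j) \<le> 2 * C * (- ln (1 - x))"
proof -
  have "(\<Sum>j=1..n. x ^ j / (real j)\<^sup>2 * csc_sq \<alpha> j) \<le> 2 * C * (\<Sum>j=1..n. x ^ j / (real j)\<^sup>2 * real j)"
    using x by (intro weighted_growth) (auto intro!: frac_le simp: mult_left_le_one_le)
  also have "(\<Sum>j=1..n. x ^ j / (real j)\<^sup>2 * real j) = (\<Sum>j=1..n. x ^ j / real j)"
    by (intro sum.cong) (auto simp: power2_eq_square)
  also have "2 * C * \<dots> \<le> 2 * C * (- ln (1 - x))"
    using sum_power_over_nat_le[OF x, of n] C_ge_1 by (intro mult_left_mono) auto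
  finally show ?thesis by simp
qed

end

text \<open>The smoothing parameter of the Fourier series is \<open>r = \<rho>\<^sup>2\<close>. Keeping its square root as the parameter
leaves a spare factor \<open>\<rho>^m\<close> when one power of \<open>\<rho>\<close> has been spent on the convergence of an inner sum.\<close>

definition coeff :: "real \<Rightarrow> nat \<Rightarrow> real" where
  "coeff \<rho> m = \<rho> ^ (2 * m) / (2 * real m * sin (pi * real m * \<alpha>))"

definition oscillation :: "real \<Rightarrow> nat \<Rightarrow> real \<Rightarrow> real" where
  "oscillation \<rho> X t = (\<Sum>m=1..X. coeff \<rho> m * sin (2 * t * (pi * real m * \<alpha>)))"

definition energy :: "real \<Rightarrow> nat \<Rightarrow> real" where
  "energy \<rho> X = (\<Sum>m=1..X. (coeff \<rho> m)\<^sup>2)"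

lemma coeff_sq: "(coeff \<rho> m)\<^sup>2 = \<rho> ^ (4 * m) * csc_sq \<alpha> m / (4 * (real m)\<^sup>2)"
  by (simp add: coeff_def csc_sq_def power_divide power_mult_distrib flip: power_mult)

text \<open>Summing \<open>sin ((2N+1) \<pi> m \<alpha>)\<close> over \<open>N\<close> costs at most \<open>1 / \<bar>sin (\<pi> m \<alpha>)\<bar>\<close>, independently of \<open>M\<close>. Together
with the denominator of the coefficient this produces \<open>csc_sq \<alpha> m / m\<close>, whose weighted sum has order
\<open>1 / (1 - \<rho>)\<close>.\<close>

lemma abs_sum_oscillation_le:
  assumes \<rho>: "0 \<le> \<rho>" "\<rho> < 1"
  shows "\<bar>\<Sum>N=1..M. oscillation \<rho> X (real N + 1/2)\<bar> \<le> C / (1 - \<rho>)"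
proof -
  have "(\<Sum>N=1..M. oscillation \<rho> X (real N + 1/2))
     = (\<Sum>m=1..X. coeff \<rho> m * (\<Sum>N=1..M. sin ((2 * real N + 1) * (pi * real m * \<alpha>))))"
    unfolding oscillation_def by (subst sum.swap) (simp add: sum_distrib_left algebra_simps)
  also have "\<bar>\<dots>\<bar> \<le> (\<Sum>m=1..X. \<bar>coeff \<rho> m\<bar> * (1 / \<bar>sin (pi * real m * \<alpha>)\<bar>))"
  proof (rule order.trans[OF sum_abs], intro sum_mono)
    fix m assume "m \<in> {1..X}"
    then show "\<bar>coeff \<rho> m * (\<Sum>N=1..M. sin ((2 * real N + 1) * (pi * real m * \<alpha>)))\<bar>
       \<le> \<bar>coeff \<rho> m\<bar> * (1 / \<bar>sin (pi * real m * \<alpha>)\<bar>)"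
      using sum_sin_odd_le[OF sin_nonzero[of m], of M] unfolding abs_mult[of "coeff \<rho> m"]
      by (intro mult_left_mono) auto
  qed
  also have "\<dots> \<le> (\<Sum>m=1..X. 1/2 * (\<rho> ^ m / real m * csc_sq \<alpha> m))"
  proof (intro sum_mono)
    fix m assume "m \<in> {1..X}"
    have "\<bar>coeff \<rho> m\<bar> * (1 / \<bar>sin (pi * real m * \<alpha>)\<bar>) = \<rho> ^ (2 * m) / (2 * real m) * csc_sq \<alpha> m"
      using \<rho> by (simp add: coeff_def csc_sq_def abs_mult power2_eq_square)
    also have "\<dots> \<le> \<rho> ^ m / (2 * real m) * csc_sq \<alpha> m"
      using \<rho> by (intro mult_right_mono divide_right_mono power_decreasing) auto
    finally show "\<bar>coeff \<rho> m\<bar> * (1 / \<bar>sin (pi * real m * \<alpha>)\<bar>) \<le> 1/2 * (\<rho> ^ m / real m * csc_sq \<alpha> m)"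
      by simp
  qed
  also have "\<dots> \<le> 1/2 * (2 * C / (1 - \<rho>))"
    unfolding sum_distrib_left[symmetric]
    by (intro mult_left_mono sum_power_csc_sq_over_nat_le \<rho>) auto
  finally show ?thesis by simp
qed

lemma energy_le:
  assumes \<rho>: "0 \<le> \<rho>" "\<rho> < 1"
  shows "energy \<rho> X \<le> C * (- ln (1 - \<rho>)) / 2"
proof -
  have "energy \<rho> X \<le> (\<Sum>m=1..X. 1/4 * (\<rho> ^ m / (real m)\<^sup>2 * csc_sq \<alpha> m))"
    unfolding energy_def
  proof (intro sum_mono)
    fix m
    have "\<rho> ^ (4 * m) * csc_sq \<alpha> m / (4 * (real m)\<^sup>2) \<le> \<rho> ^ m * csc_sq \<alpha> m / (4 * (real m)\<^sup>2)"
      using \<rho> by (intro divide_right_mono mult_right_mono power_decreasing) auto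
    then show "(coeff \<rho> m)\<^sup>2 \<le> 1/4 * (\<rho> ^ m / (real m)\<^sup>2 * csc_sq \<alpha> m)"
      by (simp add: coeff_sq)
  qed
  also have "\<dots> \<le> 1/4 * (2 * C * (- ln (1 - \<rho>)))"
    unfolding sum_distrib_left[symmetric]
    by (intro mult_left_mono sum_power_csc_sq_over_square_le \<rho>) auto
  finally show ?thesis by simp
qed

lemma abs_fejer_le: "j \<ge> 1 \<Longrightarrow> \<bar>fejer L t (pi * real j * \<alpha>)\<bar> \<le> csc_sq \<alpha> j"
  unfolding csc_sq_def by (intro abs_fejer_sum_le sin_nonzero)

text \<open>A bound for the Fejer kernels at the difference and at the sum of the frequencies \<open>\<pi> m \<alpha>\<close> and
\<open>\<pi> k \<alpha>\<close>. At \<open>m = k\<close> the difference gives the diagonal main term and is left out, but the sum still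
counts as error.\<close>

definition offdiag :: "nat \<Rightarrow> nat \<Rightarrow> real" where
  "offdiag m k = (if m = k then 0 else csc_sq \<alpha> (if m < k then k - m else m - k)) + csc_sq \<alpha> (m + k)"

lemma offdiag_commute: "offdiag m k = offdiag k m"
  by (auto simp: offdiag_def add.commute)

lemma offdiag_nonneg: "offdiag m k \<ge> 0"
  by (auto simp: offdiag_def)

lemma sum_oscillation_sq_eq:
  "(\<Sum>i<L. \<Sum>k<L. (oscillation \<rho> X (t + real i - real k))\<^sup>2)
     = 1/2 * (\<Sum>m=1..X. \<Sum>n=1..X. coeff \<rho> m * coeff \<rho> n *
         (fejer L t (pi * real m * \<alpha> - pi * real n * \<alpha>) - fejer L t (pi * real m * \<alpha> + pi * real n * \<alpha>)))"
proof -
  let ?x = "\<lambda>m::nat. pi * real m * \<alpha>"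
  let ?G = "\<lambda>s m n. 1/2 * (coeff \<rho> m * coeff \<rho> n * (cos (2 * s * (?x m - ?x n)) - cos (2 * s * (?x m + ?x n))))"
  have pt: "(oscillation \<rho> X s)\<^sup>2 = (\<Sum>m=1..X. \<Sum>n=1..X. ?G s m n)" for s
  proof -
    have "sin (2 * s * y) * sin (2 * s * z) = 1/2 * (cos (2 * s * (y - z)) - cos (2 * s * (y + z)))" for y z
      by (simp add: sin_times_sin right_diff_distrib distrib_left)
    then have "coeff \<rho> m * sin (2 * s * ?x m) * (coeff \<rho> n * sin (2 * s * ?x n)) = ?G s m n" for m n
      by (metis (no_types, lifting) mult.assoc mult.left_commute)
    then show ?thesis unfolding oscillation_def power2_eq_square sum_product by (intro sum.cong refl)
  qed
  have "(\<Sum>i<L. \<Sum>k<L. (oscillation \<rho> X (t + real i - real k))\<^sup>2)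
    = (\<Sum>m=1..X. \<Sum>n=1..X. \<Sum>i<L. \<Sum>k<L. ?G (t + real i - real k) m n)"
    unfolding pt by (rule sum_swap4)
  also have "\<dots> = (\<Sum>m=1..X. \<Sum>n=1..X. 1/2 * (coeff \<rho> m * coeff \<rho> n *
         (fejer L t (?x m - ?x n) - fejer L t (?x m + ?x n))))"
    unfolding fejer_def by (intro sum.cong refl) (simp only: sum_distrib_left[symmetric] sum_subtractf)
  finally show ?thesis by (simp add: sum_distrib_left)
qed

text \<open>Substitute \<open>j = n - m\<close>, \<open>j = m - n\<close> and \<open>j = m + n\<close>, respectively. In the first and the third case
\<open>\<rho>^(2(m+n)) \<le> \<rho>^m \<rho>^j\<close>, and the sum over \<open>j\<close> is of order \<open>1 / (1 - \<rho>)\<^sup>2\<close>; in the second case \<open>j < m\<close> and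
the growth hypothesis applies without a weight.\<close>

lemma sum_offdiag_le:
  assumes \<rho>: "0 \<le> \<rho>" "\<rho> < 1" and m: "m \<ge> 1"
  shows "(\<Sum>n=1..X. \<rho> ^ (2 * (m + n)) * offdiag m n) \<le> \<rho> ^ m * (4 * C / (1 - \<rho>)\<^sup>2 + C * (real m)\<^sup>2)"
proof -
  have pow: "\<rho> ^ b \<le> \<rho> ^ a" if "a \<le> b" for a b :: nat
    using that \<rho> by (intro power_decreasing) auto
  let ?p = "\<lambda>n. \<rho> ^ (2 * (m + n))"
  have split: "(\<Sum>n=1..X. ?p n * offdiag m n)
     = (\<Sum>n\<in>{n\<in>{1..X}. n > m}. ?p n * csc_sq \<alpha> (n - m))
     + (\<Sum>n\<in>{n\<in>{1..X}. n < m}. ?p n * csc_sq \<alpha> (m - n))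
     + (\<Sum>n=1..X. ?p n * csc_sq \<alpha> (m + n))"
  proof -
    have "?p n * offdiag m n = (if n > m then ?p n * csc_sq \<alpha> (n - m) else 0)
       + (if n < m then ?p n * csc_sq \<alpha> (m - n) else 0) + ?p n * csc_sq \<alpha> (m + n)" for n
      by (auto simp: offdiag_def distrib_left)
    then show ?thesis by (simp only: sum.distrib sum.inter_filter finite_atLeastAtMost)
  qed
  have "(\<Sum>n\<in>{n\<in>{1..X}. n > m}. ?p n * csc_sq \<alpha> (n - m)) = (\<Sum>j=1..X - m. ?p (m + j) * csc_sq \<alpha> j)"
    by (rule sum.reindex_bij_witness[of _ "\<lambda>j. m + j" "\<lambda>n. n - m"]) auto
  also have "\<dots> \<le> (\<Sum>j=1..X - m. \<rho> ^ m * (\<rho> ^ j * csc_sq \<alpha> j))"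
    unfolding mult.assoc[symmetric] power_add[symmetric] by (intro sum_mono mult_right_mono pow) auto
  also have "\<dots> \<le> \<rho> ^ m * (2 * C / (1 - \<rho>)\<^sup>2)"
    unfolding sum_distrib_left[symmetric] using \<rho> by (intro mult_left_mono sum_power_csc_sq_le) auto
  finally have above: "(\<Sum>n\<in>{n\<in>{1..X}. n > m}. ?p n * csc_sq \<alpha> (n - m)) \<le> \<rho> ^ m * (2 * C / (1 - \<rho>)\<^sup>2)" .
  have "(\<Sum>n\<in>{n\<in>{1..X}. n < m}. ?p n * csc_sq \<alpha> (m - n)) \<le> (\<Sum>n\<in>{n\<in>{1..X}. n < m}. \<rho> ^ m * csc_sq \<alpha> (m - n))"
    by (intro sum_mono mult_right_mono pow) auto
  also have "\<dots> \<le> (\<Sum>n=1..<m. \<rho> ^ m * csc_sq \<alpha> (m - n))"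
    using \<rho> by (intro sum_mono2) auto
  also have "\<dots> = (\<Sum>j=1..<m. \<rho> ^ m * csc_sq \<alpha> j)"
    by (rule sum.reindex_bij_witness[of _ "\<lambda>j. m - j" "\<lambda>n. m - n"]) auto
  also have "\<dots> \<le> (\<Sum>j=1..m. \<rho> ^ m * csc_sq \<alpha> j)"
    using \<rho> by (intro sum_mono2) auto
  also have "\<dots> \<le> \<rho> ^ m * (C * (real m)\<^sup>2)"
    unfolding sum_distrib_left[symmetric] using \<rho> by (intro mult_left_mono growth) auto
  finally have below: "(\<Sum>n\<in>{n\<in>{1..X}. n < m}. ?p n * csc_sq \<alpha> (m - n)) \<le> \<rho> ^ m * (C * (real m)\<^sup>2)" .
  have "(\<Sum>n=1..X. ?p n * csc_sq \<alpha> (m + n)) = (\<Sum>j=m+1..m+X. \<rho> ^ (2 * j) * csc_sq \<alpha> j)"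
    by (rule sum.reindex_bij_witness[of _ "\<lambda>j. j - m" "\<lambda>n. m + n"]) auto
  also have "\<dots> \<le> (\<Sum>j=m+1..m+X. \<rho> ^ m * (\<rho> ^ j * csc_sq \<alpha> j))"
    unfolding mult.assoc[symmetric] power_add[symmetric] by (intro sum_mono mult_right_mono pow) auto
  also have "\<dots> \<le> (\<Sum>j=1..m+X. \<rho> ^ m * (\<rho> ^ j * csc_sq \<alpha> j))"
    using \<rho> by (intro sum_mono2) auto
  also have "\<dots> \<le> \<rho> ^ m * (2 * C / (1 - \<rho>)\<^sup>2)"
    unfolding sum_distrib_left[symmetric] using \<rho> by (intro mult_left_mono sum_power_csc_sq_le) auto
  finally have plus: "(\<Sum>n=1..X. ?p n * csc_sq \<alpha> (m + n)) \<le> \<rho> ^ m * (2 * C / (1 - \<rho>)\<^sup>2)" .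
  have "\<rho> ^ m * (4 * C / (1 - \<rho>)\<^sup>2 + C * (real m)\<^sup>2)
    = \<rho> ^ m * (2 * C / (1 - \<rho>)\<^sup>2) + \<rho> ^ m * (C * (real m)\<^sup>2) + \<rho> ^ m * (2 * C / (1 - \<rho>)\<^sup>2)"
    by (simp add: algebra_simps add_divide_distrib[symmetric])
  then show ?thesis unfolding split using above below plus by linarith
qed

lemma abs_coeff_mult_le:
  assumes "0 \<le> \<rho>"
  shows "\<bar>coeff \<rho> m * coeff \<rho> n\<bar>
    \<le> \<rho> ^ (2 * (m + n)) * (1/8 * (csc_sq \<alpha> m / (real m)\<^sup>2 + csc_sq \<alpha> n / (real n)\<^sup>2))"
proof -
  define b where "b m = 1 / (real m * \<bar>sin (pi * real m * \<alpha>)\<bar>)" for m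
  have b2: "(b m)\<^sup>2 = csc_sq \<alpha> m / (real m)\<^sup>2" for m
    by (simp add: b_def csc_sq_def power_divide power_mult_distrib mult.commute)
  have "\<bar>coeff \<rho> m * coeff \<rho> n\<bar> = \<rho> ^ (2 * (m + n)) * (1/4 * (b m * b n))"
    using assms by (simp add: coeff_def b_def abs_mult distrib_left power_add)
  also have "\<dots> \<le> \<rho> ^ (2 * (m + n)) * (1/8 * ((b m)\<^sup>2 + (b n)\<^sup>2))"
    using sum_squares_bound[of "b m" "b n"] assms by (intro mult_left_mono) auto
  finally show ?thesis by (simp only: b2)
qed

text \<open>Large sieve with Fejer weights. The diagonal terms add up to \<open>1/2 L\<^sup>2\<close> times the energy. In the
off-diagonal terms the product \<open>\<bar>coeff \<rho> m coeff \<rho> n\<bar>\<close> is split by the inequality between the geometric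
and the arithmetic mean, after which symmetry leaves a single sum over \<open>m\<close> with inner sums bounded by
\<open>sum_offdiag_le\<close>. The error does not depend on \<open>L\<close>, so it is of smaller relative size for larger \<open>L\<close>.\<close>

lemma second_moment:
  assumes \<rho>: "0 \<le> \<rho>" "\<rho> < 1"
  shows "\<bar>(\<Sum>i<L. \<Sum>k<L. (oscillation \<rho> X (t + real i - real k))\<^sup>2) - 1/2 * (real L)\<^sup>2 * energy \<rho> X\<bar>
    \<le> C\<^sup>2 * (1 - ln (1 - \<rho>)) / (1 - \<rho>)\<^sup>2"
proof -
  let ?x = "\<lambda>m::nat. pi * real m * \<alpha>"
  let ?u = "\<lambda>m. csc_sq \<alpha> m / (real m)\<^sup>2"
  define \<Lambda> where "\<Lambda> = - ln (1 - \<rho>)"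
  have \<Lambda>: "\<Lambda> \<ge> 0" using \<rho> by (simp add: \<Lambda>_def)
  let ?E = "\<lambda>m n. coeff \<rho> m * coeff \<rho> n * (fejer L t (?x m - ?x n) - fejer L t (?x m + ?x n))
     - (if m = n then (coeff \<rho> m)\<^sup>2 * (real L)\<^sup>2 else 0)"
  have E_le: "\<bar>?E m n\<bar> \<le> \<rho> ^ (2 * (m + n)) * (1/8 * (?u m + ?u n)) * offdiag m n"
    if mn: "m \<in> {1..X}" "n \<in> {1..X}" for m n
  proof -
    have plus: "\<bar>fejer L t (?x m + ?x n)\<bar> \<le> csc_sq \<alpha> (m + n)"
      using abs_fejer_le[of "m + n" L t] mn by (simp add: algebra_simps)
    have "\<bar>?E m n\<bar> \<le> \<bar>coeff \<rho> m * coeff \<rho> n\<bar> * offdiag m n"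
    proof (cases "m = n")
      case True
      then have "?E m n = - (coeff \<rho> m * coeff \<rho> n * fejer L t (?x m + ?x n))"
        by (simp add: fejer_0 right_diff_distrib power2_eq_square)
      then show ?thesis using plus True by (simp add: abs_mult offdiag_def mult_left_mono)
    next
      case False
      let ?d = "if m < n then n - m else m - n"
      have "fejer L t (?x m - ?x n) = fejer L t (pi * real ?d * \<alpha>)"
      proof (cases "m < n")
        case True
        then have "?x m - ?x n = - (pi * real ?d * \<alpha>)" by (simp add: of_nat_diff algebra_simps)
        then show ?thesis by (simp only: fejer_minus)
      next
        case nless: False
        then have "?x m - ?x n = pi * real ?d * \<alpha>" by (simp add: of_nat_diff algebra_simps)
        then show ?thesis by (simp only:)
      qed
      moreover have "?d \<ge> 1" using False by auto
      ultimately have minus: "\<bar>fejer L t (?x m - ?x n)\<bar> \<le> csc_sq \<alpha> ?d"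
        by (simp only: abs_fejer_le)
      have "\<bar>fejer L t (?x m - ?x n) - fejer L t (?x m + ?x n)\<bar> \<le> offdiag m n"
        using plus minus False unfolding offdiag_def by simp
      then show ?thesis using False by (simp add: abs_mult mult_left_mono)
    qed
    also have "\<dots> \<le> \<rho> ^ (2 * (m + n)) * (1/8 * (?u m + ?u n)) * offdiag m n"
      using \<rho> by (intro mult_right_mono abs_coeff_mult_le offdiag_nonneg) auto
    finally show ?thesis .
  qed
  define W where "W = (\<Sum>m=1..X. \<Sum>n=1..X. ?u m * (\<rho> ^ (2 * (m + n)) * offdiag m n))"
  have W_swap: "W = (\<Sum>m=1..X. \<Sum>n=1..X. ?u n * (\<rho> ^ (2 * (m + n)) * offdiag m n))"
    unfolding W_def by (subst sum.swap) (simp only: offdiag_commute add.commute)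
  have W_le: "W \<le> 2 * C\<^sup>2 * (4 * \<Lambda> + 1) / (1 - \<rho>)\<^sup>2"
  proof -
    have "W \<le> (\<Sum>m=1..X. ?u m * (\<rho> ^ m * (4 * C / (1 - \<rho>)\<^sup>2 + C * (real m)\<^sup>2)))"
      unfolding W_def sum_distrib_left[symmetric]
      by (intro sum_mono mult_left_mono sum_offdiag_le \<rho>) auto
    also have "\<dots> = 4 * C / (1 - \<rho>)\<^sup>2 * (\<Sum>m=1..X. \<rho> ^ m / (real m)\<^sup>2 * csc_sq \<alpha> m)
       + C * (\<Sum>m=1..X. \<rho> ^ m * csc_sq \<alpha> m)"
      unfolding sum_distrib_left sum.distrib[symmetric] by (intro sum.cong) (auto simp: field_simps)
    also have "\<dots> \<le> 4 * C / (1 - \<rho>)\<^sup>2 * (2 * C * (- ln (1 - \<rho>))) + C * (2 * C / (1 - \<rho>)\<^sup>2)"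
      using C_ge_1 by (intro add_mono mult_left_mono sum_power_csc_sq_over_square_le sum_power_csc_sq_le \<rho>) auto
    also have "\<dots> = 2 * C\<^sup>2 * (4 * \<Lambda> + 1) / (1 - \<rho>)\<^sup>2"
    proof -
      have "4 * C / d * (2 * C * l) + C * (2 * C / d) = 2 * C\<^sup>2 * (4 * l + 1) / d" for d l :: real
        by (cases "d = 0") (auto simp: field_simps power2_eq_square)
      then show ?thesis unfolding \<Lambda>_def .
    qed
    finally show ?thesis .
  qed
  have eq: "(\<Sum>i<L. \<Sum>k<L. (oscillation \<rho> X (t + real i - real k))\<^sup>2) - 1/2 * (real L)\<^sup>2 * energy \<rho> X
     = 1/2 * (\<Sum>m=1..X. \<Sum>n=1..X. ?E m n)"
  proof -
    have "(real L)\<^sup>2 * energy \<rho> X = (\<Sum>m=1..X. \<Sum>n=1..X. if m = n then (coeff \<rho> m)\<^sup>2 * (real L)\<^sup>2 else 0)"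
      by (simp add: energy_def sum_distrib_left mult.commute)
    then show ?thesis unfolding sum_oscillation_sq_eq by (simp only: sum_subtractf right_diff_distrib mult.assoc)
  qed
  have "\<bar>\<Sum>m=1..X. \<Sum>n=1..X. ?E m n\<bar>
     \<le> (\<Sum>m=1..X. \<Sum>n=1..X. \<rho> ^ (2 * (m + n)) * (1/8 * (?u m + ?u n)) * offdiag m n)"
  proof (rule order.trans[OF sum_abs], rule sum_mono)
    fix m assume m: "m \<in> {1..X}"
    show "\<bar>\<Sum>n=1..X. ?E m n\<bar> \<le> (\<Sum>n=1..X. \<rho> ^ (2 * (m + n)) * (1/8 * (?u m + ?u n)) * offdiag m n)"
      by (rule order.trans[OF sum_abs], rule sum_mono, rule E_le[OF m])
  qed
  also have "\<dots> = 1/8 * (W + W)"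
  proof -
    have "W + W = (\<Sum>m=1..X. \<Sum>n=1..X. ?u m * (\<rho> ^ (2 * (m + n)) * offdiag m n) + ?u n * (\<rho> ^ (2 * (m + n)) * offdiag m n))"
      by (subst (2) W_swap) (simp only: W_def sum.distrib)
    then show ?thesis by (simp add: sum_distrib_left algebra_simps)
  qed
  finally have "\<bar>(\<Sum>i<L. \<Sum>k<L. (oscillation \<rho> X (t + real i - real k))\<^sup>2) - 1/2 * (real L)\<^sup>2 * energy \<rho> X\<bar> \<le> 1/8 * W"
    unfolding eq abs_mult by simp
  also have "\<dots> \<le> C\<^sup>2 * (4 * \<Lambda> + 1) / (4 * (1 - \<rho>)\<^sup>2)" using W_le by simp
  also have "\<dots> \<le> C\<^sup>2 * (4 * (1 + \<Lambda>)) / (4 * (1 - \<rho>)\<^sup>2)"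
    using \<Lambda> by (intro divide_right_mono mult_left_mono) auto
  also have "\<dots> = C\<^sup>2 * (1 + \<Lambda>) / (1 - \<rho>)\<^sup>2"
  proof -
    have "C\<^sup>2 * (4 * a) / (4 * d) = C\<^sup>2 * a / d" for a d :: real by simp
    then show ?thesis .
  qed
  finally show ?thesis unfolding \<Lambda>_def by simp
qed

end

section \<open>The smoothed logarithm\<close>

text \<open>The logarithm is that of \<open>\<bar>1 - r e^(2 i \<theta>)\<bar>\<close>, since \<open>\<bar>1 - r e^(2 i \<theta>)\<bar>\<^sup>2 = (1 - r)\<^sup>2 + 4 r sin\<^sup>2 \<theta>\<close>; the series
is the real part of the Taylor series of the complex logarithm.\<close>

lemma power_cos_over_nat_sums:
  fixes r \<theta> :: real
  assumes r: "0 \<le> r" "r < 1"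
  shows "(\<lambda>m. r ^ m * cos (2 * real m * \<theta>) / real m) sums (- (1/2) * ln ((1 - r)\<^sup>2 + 4 * r * (sin \<theta>)\<^sup>2))"
proof -
  define z where "z = of_real r * cis (2 * \<theta>)"
  have z: "cmod (- z) < 1" using r by (simp add: z_def norm_mult)
  have nz: "1 - z \<noteq> 0" using z by auto
  have zn: "z ^ n = of_real (r ^ n) * cis (2 * real n * \<theta>)" for n
    by (simp add: z_def power_mult_distrib Complex.DeMoivre mult_ac)
  have "(\<lambda>n. Re (- (z ^ n) / of_nat n)) sums Re (ln (1 - z))"
    using sums_Re[OF Ln_series'[OF z]] by simp
  also have "Re (ln (1 - z)) = ln (cmod (1 - z))" using nz by simp
  also have "\<dots> = 1/2 * ln ((cmod (1 - z))\<^sup>2)" using nz by (simp add: ln_realpow)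
  also have "(cmod (1 - z))\<^sup>2 = (1 - r * cos (2 * \<theta>))\<^sup>2 + (r * sin (2 * \<theta>))\<^sup>2"
    by (simp add: cmod_power2 z_def)
  also have "\<dots> = 1 - 2 * r * cos (2 * \<theta>) + r\<^sup>2 * ((sin (2 * \<theta>))\<^sup>2 + (cos (2 * \<theta>))\<^sup>2)"
    by algebra
  also have "\<dots> = 1 - 2 * r * cos (2 * \<theta>) + r\<^sup>2" by simp
  also have "\<dots> = (1 - r)\<^sup>2 + 4 * r * (sin \<theta>)\<^sup>2"
    unfolding cos_double_sin by (simp add: power2_eq_square algebra_simps)
  finally have "(\<lambda>n. - Re (- (z ^ n) / of_nat n)) sums - (1/2 * ln ((1 - r)\<^sup>2 + 4 * r * (sin \<theta>)\<^sup>2))"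
    by (rule sums_minus)
  moreover have "- Re (- (z ^ n) / of_nat n) = r ^ n * cos (2 * real n * \<theta>) / real n" for n
    unfolding zn by (simp add: Re_divide_of_nat)
  ultimately show ?thesis by (simp only: mult_minus_left)
qed

text \<open>Dividing by \<open>4 s\<^sup>2\<close> leaves \<open>1/2 ln (r + y)\<close> with \<open>y = (1 - r)\<^sup>2 / (4 s\<^sup>2)\<close>, which lies between \<open>1/2 ln r\<close>
and \<open>y / 2\<close>.\<close>

lemma smoothing_error:
  fixes r s :: real
  assumes r: "0 < r" "r < 1" and s: "s \<noteq> 0"
  shows "\<bar>1/2 * ln ((1 - r)\<^sup>2 + 4 * r * s\<^sup>2) - ln \<bar>2 * s\<bar>\<bar> \<le> 1/2 * (- ln r + (1 - r)\<^sup>2 / 4 * (1 / s\<^sup>2))"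
proof -
  define y where "y = (1 - r)\<^sup>2 / 4 * (1 / s\<^sup>2)"
  have y: "y \<ge> 0" by (simp add: y_def)
  have "(1 - r)\<^sup>2 + 4 * r * s\<^sup>2 = (2 * s)\<^sup>2 * (r + y)" using s by (simp add: y_def field_simps power2_eq_square)
  then have "ln ((1 - r)\<^sup>2 + 4 * r * s\<^sup>2) = ln (\<bar>2 * s\<bar>\<^sup>2) + ln (r + y)"
    using s r y by (simp add: ln_mult)
  also have "ln (\<bar>2 * s\<bar>\<^sup>2) = 2 * ln \<bar>2 * s\<bar>" using ln_realpow[of "\<bar>2 * s\<bar>" 2] s by simp
  finally have "1/2 * ln ((1 - r)\<^sup>2 + 4 * r * s\<^sup>2) - ln \<bar>2 * s\<bar> = 1/2 * ln (r + y)" by linarith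
  moreover have "ln (r + y) \<le> y" using ln_le_minus_one[of "r + y"] r y by simp
  moreover have "ln r \<le> ln (r + y)" using r y by simp
  moreover have "ln r < 0" using r by simp
  moreover have "\<bar>v\<bar> \<le> 1/2 * (- l + y)" if "v = 1/2 * w" "w \<le> y" "l \<le> w" "l < 0" for v w l
    using that y by (auto simp: abs_le_iff)
  ultimately show ?thesis unfolding y_def[symmetric] by blast
qed

context csc_growth begin

lemma ln_sudler: "ln (sudler N \<alpha>) = (\<Sum>n=1..N. ln \<bar>2 * sin (pi * real n * \<alpha>)\<bar>)"
  unfolding sudler_def using sin_nonzero by (intro ln_prod) auto

lemma sum_power_cos_eq_oscillation:
  "(\<Sum>n=1..N. \<Sum>m=1..X. (\<rho>\<^sup>2) ^ m * cos (2 * real m * (pi * real n * \<alpha>)) / real m)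
     = oscillation \<rho> X (real N + 1/2) - 1/2 * (\<Sum>m=1..X. (\<rho>\<^sup>2) ^ m / real m)"
proof -
  have "(\<Sum>n=1..N. \<Sum>m=1..X. (\<rho>\<^sup>2) ^ m * cos (2 * real m * (pi * real n * \<alpha>)) / real m)
     = (\<Sum>m=1..X. (\<rho>\<^sup>2) ^ m / real m * (\<Sum>n=1..N. cos (2 * real n * (pi * real m * \<alpha>))))"
    by (subst sum.swap) (simp add: sum_distrib_left mult_ac)
  also have "\<dots> = (\<Sum>m=1..X. coeff \<rho> m * sin (2 * (real N + 1/2) * (pi * real m * \<alpha>)) - 1/2 * ((\<rho>\<^sup>2) ^ m / real m))"
  proof (intro sum.cong refl)
    fix m assume m: "m \<in> {1..X}"
    let ?s = "sin (pi * real m * \<alpha>)"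
    have s: "?s \<noteq> 0" using sin_nonzero[of m] m by simp
    let ?c = "\<Sum>n=1..N. cos (2 * real n * (pi * real m * \<alpha>))"
    let ?S = "sin (2 * (real N + 1/2) * (pi * real m * \<alpha>))"
    have "2 * ?s * ?c = ?S - ?s"
      using two_sin_sum_cos[of "pi * real m * \<alpha>" N] by (simp add: distrib_left)
    then have "?c = ?S / (2 * ?s) - 1/2" using s by (simp add: field_simps)
    then show "(\<rho>\<^sup>2) ^ m / real m * ?c = coeff \<rho> m * ?S - 1/2 * ((\<rho>\<^sup>2) ^ m / real m)"
      by (simp add: coeff_def power_mult right_diff_distrib)
  qed
  finally show ?thesis by (simp add: oscillation_def sum_subtractf sum_distrib_left)
qed

text \<open>Smoothing with \<open>1 - r \<approx> 2/R\<close> changes each of the \<open>N \<le> K R\<close> terms by \<open>O(1/R + csc_sq \<alpha> n / R\<^sup>2)\<close>, hence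
the whole sum by \<open>O(K\<^sup>2)\<close>. As only finitely many \<open>N\<close> are concerned, the Fourier series can be cut at
one common \<open>X\<close>, so that all later estimates deal with finite sums; the requirement \<open>R \<le> X\<close> keeps the
frequencies that make the energy large.\<close>

lemma ln_sudler_approx:
  assumes R: "R \<ge> 2" and K: "K \<ge> 1"
  obtains X where "R \<le> real X"
    "\<And>N. real N \<le> K * R \<Longrightarrow>
      \<bar>ln (sudler N \<alpha>) - 1/2 * ln R + oscillation (1 - 1 / R) X (real N + 1/2)\<bar> \<le> C * K\<^sup>2 + 2 * K + 2"
proof -
  define \<rho> where "\<rho> = 1 - 1 / R"
  define r where "r = \<rho>\<^sup>2"
  have \<rho>: "1/2 \<le> \<rho>" "\<rho> < 1" using R by (auto simp: \<rho>_def field_simps)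
  have r: "0 < r" "r < 1" using \<rho> by (auto simp: r_def abs_square_less_1)
  define G where "G n = 1/2 * ln ((1 - r)\<^sup>2 + 4 * r * (sin (pi * real n * \<alpha>))\<^sup>2)" for n :: nat
  define T where "T X n = (\<Sum>m=1..X. r ^ m * cos (2 * real m * (pi * real n * \<alpha>)) / real m)" for X n :: nat
  define H where "H X = (\<Sum>m=1..X. r ^ m / real m)" for X :: nat
  have shift: "(\<Sum>m<Suc X. f m) = (\<Sum>m=1..X. f m)" if "f 0 = 0" for f :: "nat \<Rightarrow> real" and X
    using that by (simp add: sum.lessThan_Suc_shift sum.atLeast1_atMost_eq del: sum.lessThan_Suc)
  have T: "(\<lambda>X. T X n) \<longlonglongrightarrow> - G n" for n
  proof -
    have "(\<lambda>X. T X n) = (\<lambda>X. \<Sum>m<Suc X. r ^ m * cos (2 * real m * (pi * real n * \<alpha>)) / real m)"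
      unfolding T_def by (intro ext shift[symmetric]) simp
    then show ?thesis
      using LIMSEQ_Suc[OF power_cos_over_nat_sums[of r "pi * real n * \<alpha>", unfolded sums_def]] r
      by (simp only: G_def mult_minus_left)
  qed
  have H: "H \<longlonglongrightarrow> - ln (1 - r)"
  proof -
    have "H = (\<lambda>X. \<Sum>m<Suc X. r ^ m / real m)"
      unfolding H_def by (intro ext shift[symmetric]) simp
    then show ?thesis
      using LIMSEQ_Suc[OF power_over_nat_sums[of r, unfolded sums_def]] r by (simp only:)
  qed
  define B where "B = {N::nat. real N \<le> K * R}"
  have fin: "finite B"
  proof (rule finite_subset)
    show "B \<subseteq> {..nat \<lfloor>K * R\<rfloor>}" unfolding B_def using le_nat_floor by blast
  qed simp
  have "\<forall>\<^sub>F X in sequentially. dist (\<Sum>n=1..N. T X n) (\<Sum>n=1..N. - G n) < 1/2" for N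
    by (intro tendstoD tendsto_sum T) simp
  then have "\<forall>\<^sub>F X in sequentially. \<forall>N\<in>B. dist (\<Sum>n=1..N. T X n) (\<Sum>n=1..N. - G n) < 1/2"
    by (intro eventually_ball_finite fin ballI)
  moreover have "\<forall>\<^sub>F X in sequentially. dist (H X) (- ln (1 - r)) < 1"
    by (intro tendstoD H) simp
  moreover have "\<forall>\<^sub>F X in sequentially. R \<le> real X"
    using filterlim_real_sequentially unfolding filterlim_at_top by blast
  ultimately have "\<forall>\<^sub>F X in sequentially. (\<forall>N\<in>B. dist (\<Sum>n=1..N. T X n) (\<Sum>n=1..N. - G n) < 1/2)
      \<and> dist (H X) (- ln (1 - r)) < 1 \<and> R \<le> real X" by eventually_elim auto
  then obtain X where X: "\<And>N. N \<in> B \<Longrightarrow> dist (\<Sum>n=1..N. T X n) (\<Sum>n=1..N. - G n) < 1/2"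
    "dist (H X) (- ln (1 - r)) < 1" "R \<le> real X"
    unfolding eventually_sequentially by blast
  show ?thesis
  proof (rule that[of X])
    fix N assume N: "real N \<le> K * R"
    have "(\<Sum>n=1..N. T X n) = oscillation \<rho> X (real N + 1/2) - 1/2 * H X"
      unfolding T_def H_def r_def by (rule sum_power_cos_eq_oscillation)
    then have trunc: "\<bar>oscillation \<rho> X (real N + 1/2) - 1/2 * H X + (\<Sum>n=1..N. G n)\<bar> \<le> 1/2"
      using X(1)[of N] N by (simp add: B_def dist_real_def sum_negf)
    have main: "\<bar>1/2 * H X - 1/2 * ln R\<bar> \<le> 1"
    proof -
      have "1 - r = (1 + \<rho>) / R" by (simp add: r_def \<rho>_def power2_eq_square algebra_simps diff_divide_distrib)
      then have "- ln (1 - r) = ln R - ln (1 + \<rho>)" using R \<rho> by (simp add: ln_div)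
      moreover have "0 \<le> ln (1 + \<rho>)" "ln (1 + \<rho>) \<le> 1" using \<rho> ln_add_one_self_le_self[of \<rho>] by auto
      ultimately show ?thesis using X(2) unfolding dist_real_def by linarith
    qed
    have smooth: "\<bar>(\<Sum>n=1..N. G n) - ln (sudler N \<alpha>)\<bar> \<le> 1/2 * (C * K\<^sup>2 + 4 * K)"
    proof -
      have "\<bar>(\<Sum>n=1..N. G n) - ln (sudler N \<alpha>)\<bar> \<le> (\<Sum>n=1..N. \<bar>G n - ln \<bar>2 * sin (pi * real n * \<alpha>)\<bar>\<bar>)"
        unfolding ln_sudler sum_subtractf[symmetric] by (rule sum_abs)
      also have "\<dots> \<le> (\<Sum>n=1..N. 1/2 * (- ln r + (1 - r)\<^sup>2 / 4 * csc_sq \<alpha> n))"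
        unfolding G_def csc_sq_def using r by (intro sum_mono smoothing_error sin_nonzero) auto
      also have "\<dots> = 1/2 * ((1 - r)\<^sup>2 / 4 * (\<Sum>n=1..N. csc_sq \<alpha> n) + real N * (- ln r))"
        by (simp only: sum_distrib_left[symmetric] sum.distrib sum_constant) simp
      also have "\<dots> \<le> 1/2 * ((1 / R)\<^sup>2 * (C * (K * R)\<^sup>2) + (K * R) * (4 / R))"
      proof (intro mult_left_mono add_mono mult_mono)
        have "(1 - r) / 2 \<le> 1 / R" using \<rho> R
          by (simp add: r_def \<rho>_def power2_eq_square field_simps)
        then have "((1 - r) / 2)\<^sup>2 \<le> (1 / R)\<^sup>2" using r by (intro power_mono) auto
        then show "(1 - r)\<^sup>2 / 4 \<le> (1 / R)\<^sup>2" by (simp add: power_divide)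
        show "(\<Sum>n=1..N. csc_sq \<alpha> n) \<le> C * (K * R)\<^sup>2"
          by (rule order.trans[OF growth]) (use N C_ge_1 in \<open>auto intro!: mult_left_mono power_mono\<close>)
        have "- (1 / R) - 2 * (1 / R)\<^sup>2 \<le> ln \<rho>"
          unfolding \<rho>_def using R by (intro ln_one_minus_pos_lower_bound) auto
        moreover have "2 * (1 / R)\<^sup>2 \<le> 1 / R" using R by (simp add: power2_eq_square field_simps)
        moreover have "ln r = 2 * ln \<rho>" using \<rho> by (simp add: r_def ln_realpow)
        ultimately show "- ln r \<le> 4 / R" by simp
        show "0 \<le> - ln r" using r by simp
      qed (use N K R C_ge_1 in \<open>auto intro!: sum_nonneg\<close>)
      also have "\<dots> = 1/2 * (C * K\<^sup>2 + 4 * K)" using R by (simp add: power_mult_distrib power_divide)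
      finally show ?thesis .
    qed
    have "0 \<le> C * K\<^sup>2" using C_ge_1 by simp
    with trunc main smooth
    show "\<bar>ln (sudler N \<alpha>) - 1/2 * ln R + oscillation (1 - 1 / R) X (real N + 1/2)\<bar> \<le> C * K\<^sup>2 + 2 * K + 2"
      unfolding \<rho>_def[symmetric] by argo
  qed (use X in simp)
qed

end

section \<open>Mean and variance\<close>

text \<open>Fejer weights centred at the origin, of length \<open>2 M\<close>, majorize \<open>M\<close> times the indicator of
\<open>1 \<le> N \<le> M\<close>: the shift \<open>N\<close> is attained by the pairs \<open>(k + N, k)\<close> with \<open>k < M\<close>.\<close>

lemma sum_le_double_sum:
  fixes g :: "real \<Rightarrow> real"
  assumes "\<And>x. g x \<ge> 0"
  shows "real M * (\<Sum>N=1..M. g (real N + 1/2)) \<le> (\<Sum>i<2*M. \<Sum>k<2*M. g (1/2 + real i - real k))"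
proof -
  have "real M * (\<Sum>N=1..M. g (real N + 1/2)) = (\<Sum>k<M. \<Sum>N=1..M. g (real N + 1/2))" by simp
  also have "\<dots> = (\<Sum>k<M. \<Sum>i\<in>{k+1..k+M}. g (1/2 + real i - real k))"
  proof (rule sum.cong[OF refl])
    fix k
    show "(\<Sum>N=1..M. g (real N + 1/2)) = (\<Sum>i\<in>{k+1..k+M}. g (1/2 + real i - real k))"
      by (rule sum.reindex_bij_witness[of _ "\<lambda>i. i - k" "\<lambda>N. k + N"]) (auto simp: add.commute)
  qed
  also have "\<dots> \<le> (\<Sum>k<M. \<Sum>i<2*M. g (1/2 + real i - real k))"
    using assms by (intro sum_mono sum_mono2) auto
  also have "\<dots> \<le> (\<Sum>k<2*M. \<Sum>i<2*M. g (1/2 + real i - real k))"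
    using assms by (intro sum_mono2 sum_nonneg) auto
  also have "\<dots> = (\<Sum>i<2*M. \<Sum>k<2*M. g (1/2 + real i - real k))" by (rule sum.swap)
  finally show ?thesis .
qed

text \<open>Conversely, Fejer weights centred at \<open>L\<close>, of length \<open>L\<close>, live inside \<open>{1..M}\<close> and are at most \<open>L\<close>.\<close>

lemma double_sum_le_sum:
  fixes g :: "real \<Rightarrow> real"
  assumes "\<And>x. g x \<ge> 0" and L: "2 * L \<le> M"
  shows "(\<Sum>i<L. \<Sum>k<L. g (real L + 1/2 + real i - real k)) \<le> real L * (\<Sum>N=1..M. g (real N + 1/2))"
proof -
  have "(\<Sum>i<L. \<Sum>k<L. g (real L + 1/2 + real i - real k)) \<le> (\<Sum>i<L. \<Sum>N=1..M. g (real N + 1/2))"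
  proof (intro sum_mono)
    fix i assume i: "i \<in> {..<L}"
    have "(\<Sum>k<L. g (real L + 1/2 + real i - real k)) = (\<Sum>N\<in>{i+1..i+L}. g (real N + 1/2))"
      by (rule sum.reindex_bij_witness[of _ "\<lambda>N. L + i - N" "\<lambda>k. L + i - k"])
        (auto simp: of_nat_diff algebra_simps)
    also have "\<dots> \<le> (\<Sum>N=1..M. g (real N + 1/2))"
      using assms i by (intro sum_mono2) auto
    finally show "(\<Sum>k<L. g (real L + 1/2 + real i - real k)) \<le> (\<Sum>N=1..M. g (real N + 1/2))" .
  qed
  then show ?thesis by simp
qed

lemma ln_ge_1: "M \<ge> 3 \<Longrightarrow> 1 \<le> ln (real M)"
  using exp_le ln_ge_iff[of "real M" 1] by fastforce

context csc_growth begin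

text \<open>With \<open>K = 1\<close>, that is \<open>R = M\<close>, both the approximation error and the mean of the oscillation are bounded.\<close>

lemma mean_log_sudler:
  assumes M: "M \<ge> 3"
  shows "\<bar>(1 / real M) * (\<Sum>N=1..M. ln (sudler N \<alpha>)) - (1/2) * ln (real M)\<bar> \<le> 2 * C + 4"
proof -
  define R where "R = real M"
  have R: "R \<ge> 3" using M by (simp add: R_def)
  obtain X where X: "\<And>N. real N \<le> 1 * R \<Longrightarrow>
      \<bar>ln (sudler N \<alpha>) - 1/2 * ln R + oscillation (1 - 1 / R) X (real N + 1/2)\<bar> \<le> C * 1\<^sup>2 + 2 * 1 + 2"
    using ln_sudler_approx[of R 1] R by auto
  then have X: "\<bar>ln (sudler N \<alpha>) - 1/2 * ln R + oscillation (1 - 1 / R) X (real N + 1/2)\<bar> \<le> C + 4"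
    if "N \<in> {1..M}" for N
    using X[of N] that by (simp add: R_def add.commute[of C 4])
  let ?Y = "\<lambda>N. oscillation (1 - 1 / R) X (real N + 1/2)"
  have "\<bar>\<Sum>N=1..M. ?Y N\<bar> \<le> C / (1 - (1 - 1 / R))"
    using R by (intro abs_sum_oscillation_le) auto
  then have Y: "\<bar>\<Sum>N=1..M. ?Y N\<bar> \<le> C * R" by simp
  have "\<bar>\<Sum>N=1..M. ln (sudler N \<alpha>) - 1/2 * ln R + ?Y N\<bar> \<le> (\<Sum>N=1..M. C + 4)"
    by (rule order.trans[OF sum_abs], rule sum_mono, rule X)
  then have E: "\<bar>(\<Sum>N=1..M. ln (sudler N \<alpha>)) - R * (1/2 * ln R) + (\<Sum>N=1..M. ?Y N)\<bar> \<le> R * (C + 4)"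
    by (simp add: sum.distrib sum_subtractf R_def)
  have "R * (C + 4) + C * R = R * (2 * C + 4)" by (simp add: algebra_simps)
  with Y E have "\<bar>(\<Sum>N=1..M. ln (sudler N \<alpha>)) - R * (1/2 * ln R)\<bar> \<le> R * (2 * C + 4)" by linarith
  moreover have "(\<Sum>N=1..M. ln (sudler N \<alpha>)) - R * (1/2 * ln R)
     = R * ((1 / R) * (\<Sum>N=1..M. ln (sudler N \<alpha>)) - (1/2) * ln R)"
    using R by (simp add: right_diff_distrib)
  ultimately have "R * \<bar>(1 / R) * (\<Sum>N=1..M. ln (sudler N \<alpha>)) - (1/2) * ln R\<bar> \<le> R * (2 * C + 4)"
    using R by (simp only: abs_mult abs_of_nonneg)
  then show ?thesis using R unfolding R_def by (simp only: mult_le_cancel_left_pos)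
qed

lemma variance_upper:
  assumes M: "M \<ge> 3"
  shows "(1 / real M) * (\<Sum>N=1..M. (ln (sudler N \<alpha>) - (1/2) * ln (real M))\<^sup>2)
    \<le> (2 * C + 4 * C\<^sup>2 + 2 * (C + 4)\<^sup>2) * ln (real M)"
proof -
  define R where "R = real M"
  have R: "R \<ge> 3" using M by (simp add: R_def)
  have lnR: "ln R \<ge> 1" unfolding R_def by (rule ln_ge_1[OF M])
  define \<rho> where "\<rho> = 1 - 1 / R"
  have \<rho>: "0 \<le> \<rho>" "\<rho> < 1" "1 - \<rho> = 1 / R" "- ln (1 - \<rho>) = ln R" using R by (auto simp: \<rho>_def ln_div)
  obtain X where X: "\<And>N. real N \<le> 1 * R \<Longrightarrow>
      \<bar>ln (sudler N \<alpha>) - 1/2 * ln R + oscillation \<rho> X (real N + 1/2)\<bar> \<le> C * 1\<^sup>2 + 2 * 1 + 2"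
    unfolding \<rho>_def using ln_sudler_approx[of R 1] R by auto
  let ?Y = "\<lambda>N. oscillation \<rho> X (real N + 1/2)"
  have "R * (\<Sum>N=1..M. (?Y N)\<^sup>2) \<le> (\<Sum>i<2*M. \<Sum>k<2*M. (oscillation \<rho> X (1/2 + real i - real k))\<^sup>2)"
    unfolding R_def by (rule sum_le_double_sum) simp
  also have "\<dots> \<le> 1/2 * (real (2 * M))\<^sup>2 * energy \<rho> X + C\<^sup>2 * (1 - ln (1 - \<rho>)) / (1 - \<rho>)\<^sup>2"
    using second_moment[OF \<rho>(1,2), where L = "2 * M" and X = X and t = "1/2"] by linarith
  also have "\<dots> \<le> 1/2 * (real (2 * M))\<^sup>2 * (C * (- ln (1 - \<rho>)) / 2) + C\<^sup>2 * (1 - ln (1 - \<rho>)) / (1 - \<rho>)\<^sup>2"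
    by (intro add_right_mono mult_left_mono energy_le \<rho>) auto
  also have "\<dots> = R * (R * (C * ln R + C\<^sup>2 * (1 + ln R)))"
    unfolding \<rho>(3) using \<rho>(4) R by (simp add: R_def power2_eq_square ln_div algebra_simps)
  finally have Y: "(\<Sum>N=1..M. (?Y N)\<^sup>2) \<le> R * (C * ln R + C\<^sup>2 * (1 + ln R))"
    using R by (simp only: mult_le_cancel_left_pos)
  have "(ln (sudler N \<alpha>) - (1/2) * ln R)\<^sup>2 \<le> 2 * (?Y N)\<^sup>2 + 2 * (C + 4)\<^sup>2" if "N \<in> {1..M}" for N
  proof -
    define e where "e = ln (sudler N \<alpha>) - 1/2 * ln R + ?Y N"
    have "\<bar>e\<bar> \<le> \<bar>C + 4\<bar>" using X[of N] that unfolding e_def by (simp add: R_def)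
    then have "e\<^sup>2 \<le> (C + 4)\<^sup>2" by (simp only: abs_le_square_iff)
    moreover have "(ln (sudler N \<alpha>) - (1/2) * ln R)\<^sup>2 = (e - ?Y N)\<^sup>2" by (simp add: e_def)
    moreover have "(e - ?Y N)\<^sup>2 \<le> 2 * (?Y N)\<^sup>2 + 2 * e\<^sup>2"
      using zero_le_power2[of "e + ?Y N"] by (simp add: power2_eq_square algebra_simps)
    ultimately show ?thesis by linarith
  qed
  then have "(\<Sum>N=1..M. (ln (sudler N \<alpha>) - (1/2) * ln R)\<^sup>2) \<le> (\<Sum>N=1..M. 2 * (?Y N)\<^sup>2 + 2 * (C + 4)\<^sup>2)"
    by (rule sum_mono)
  also have "\<dots> = 2 * (\<Sum>N=1..M. (?Y N)\<^sup>2) + R * (2 * (C + 4)\<^sup>2)"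
    by (simp add: sum.distrib sum_distrib_left R_def)
  also have "\<dots> \<le> 2 * (R * (C * ln R + C\<^sup>2 * (1 + ln R))) + R * (2 * (C + 4)\<^sup>2)"
    using Y by simp
  also have "\<dots> = R * (2 * C * ln R + 2 * C\<^sup>2 * (1 + ln R) + 2 * (C + 4)\<^sup>2 * 1)"
    by (simp add: algebra_simps)
  also have "\<dots> \<le> R * (2 * C * ln R + 2 * C\<^sup>2 * (ln R + ln R) + 2 * (C + 4)\<^sup>2 * ln R)"
    using R lnR C_ge_1 by (intro mult_left_mono add_mono) auto
  also have "\<dots> = R * ((2 * C + 4 * C\<^sup>2 + 2 * (C + 4)\<^sup>2) * ln R)" by (simp add: algebra_simps)
  finally show ?thesis unfolding R_def[symmetric] using R by (simp add: field_simps)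
qed

text \<open>If the sum vanished then \<open>P\<^sub>1 = P\<^sub>2\<close>, that is \<open>\<bar>sin (2 \<pi> \<alpha>)\<bar> = 1/2\<close>. Then \<open>cos (6 \<pi> \<alpha>) = 0\<close> by the formula
for the triple angle, so \<open>sin (12 \<pi> \<alpha>) = 0\<close>, which \<open>sin_nonzero\<close> excludes.\<close>

lemma variance_positive:
  assumes M: "M \<ge> 3"
  shows "(\<Sum>N=1..M. (ln (sudler N \<alpha>) - (1/2) * ln (real M))\<^sup>2) > 0"
proof (rule ccontr)
  assume "\<not> ?thesis"
  moreover have "(\<Sum>N=1..M. (ln (sudler N \<alpha>) - (1/2) * ln (real M))\<^sup>2) \<ge> 0" by (intro sum_nonneg) auto
  ultimately have "(\<Sum>N=1..M. (ln (sudler N \<alpha>) - (1/2) * ln (real M))\<^sup>2) = 0" by linarith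
  then have zero: "ln (sudler N \<alpha>) = (1/2) * ln (real M)" if "N \<in> {1..M}" for N
    using that by (subst (asm) sum_nonneg_eq_0_iff) auto
  have "ln (sudler 2 \<alpha>) = ln (sudler 1 \<alpha>)" using zero[of 1] zero[of 2] M by simp
  then have "ln \<bar>2 * sin (pi * real 2 * \<alpha>)\<bar> = 0" unfolding ln_sudler by (simp add: numeral_2_eq_2)
  then have "\<bar>2 * sin (pi * real 2 * \<alpha>)\<bar> = 1" using sin_nonzero[of 2] by simp
  then have sq: "(2 * sin (pi * real 2 * \<alpha>))\<^sup>2 = 1" by (metis one_power2 power2_abs)
  define s where "s = sin (2 * pi * \<alpha>)"
  have s: "4 * (s * s) = 1" using sq by (simp add: s_def power2_eq_square mult_ac)
  define c where "c = cos (2 * pi * \<alpha>)"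
  have sc: "s * s + c * c = 1" by (simp add: s_def c_def flip: power2_eq_square)
  have c: "4 * (c * c) = 3" using s sc by linarith
  have "cos (3 * (2 * pi * \<alpha>)) = 4 * c ^ 3 - 3 * c"
    unfolding c_def by (rule cos_treble_cos)
  also have "\<dots> = (4 * (c * c) - 3) * c" by (simp add: power3_eq_cube algebra_simps)
  finally have "cos (3 * (2 * pi * \<alpha>)) = 0" using c by simp
  then have "sin (2 * (3 * (2 * pi * \<alpha>))) = 0" by (simp only: sin_double mult_zero_right)
  moreover have "2 * (3 * (2 * pi * \<alpha>)) = pi * real 12 * \<alpha>" by simp
  ultimately have "sin (pi * real 12 * \<alpha>) = 0" by (simp only:)
  then show False using sin_nonzero[of 12] by simp
qed

text \<open>For \<open>m \<le> R\<close> the smoothing factor \<open>\<rho>^(4m)\<close> is bounded below by an absolute constant, so the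
energy inherits the lower bound of \<open>sum_csc_sq_over_square_ge\<close>.\<close>

lemma energy_ge:
  assumes c: "0 < c" "c \<le> 1/2" "\<And>q::nat. q \<ge> 1 \<Longrightarrow> c \<le> real q * dist_nearest_int (real q * \<alpha>)"
    and R: "R \<ge> 2" and X: "R \<le> real X"
  shows "energy (1 - 1 / R) X \<ge> exp (- 8) / 4 * ((ln R / ln (2 / c) - 1) / pi\<^sup>2)"
proof -
  define \<rho> where "\<rho> = 1 - 1 / R"
  have \<rho>: "0 < \<rho>" using R by (simp add: \<rho>_def)
  have "- (1 / R) - 2 * (1 / R)\<^sup>2 \<le> ln \<rho>"
    unfolding \<rho>_def using R by (intro ln_one_minus_pos_lower_bound) auto
  moreover have "2 * (1 / R)\<^sup>2 \<le> 1 / R" using R by (simp add: power2_eq_square field_simps)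
  ultimately have ln\<rho>: "- 2 / R \<le> ln \<rho>" by simp
  have pow: "exp (- 8) \<le> \<rho> ^ (4 * m)" if m: "real m \<le> R" for m
  proof -
    have "real m / R \<le> 1" using m R by simp
    then have "- 8 \<le> real (4 * m) * (- 2 / R)" by simp
    also have "\<dots> \<le> real (4 * m) * ln \<rho>" by (intro mult_left_mono ln\<rho>) simp
    finally have "exp (- 8) \<le> exp (real (4 * m) * ln \<rho>)" by simp
    also have "\<dots> = \<rho> ^ (4 * m)" using \<rho> by (simp only: exp_of_nat_mult exp_ln)
    finally show ?thesis .
  qed
  let ?A = "{m\<in>{1..X}. real m \<le> R}"
  have "exp (- 8) / 4 * ((ln R / ln (2 / c) - 1) / pi\<^sup>2)
      \<le> exp (- 8) / 4 * (\<Sum>m\<in>?A. csc_sq \<alpha> m / (real m)\<^sup>2)"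
    using R by (intro mult_left_mono sum_csc_sq_over_square_ge c X) auto
  also have "\<dots> = (\<Sum>m\<in>?A. exp (- 8) * (csc_sq \<alpha> m / (4 * (real m)\<^sup>2)))"
    unfolding sum_distrib_left by (intro sum.cong) auto
  also have "\<dots> \<le> (\<Sum>m\<in>?A. \<rho> ^ (4 * m) * (csc_sq \<alpha> m / (4 * (real m)\<^sup>2)))"
    by (intro sum_mono mult_right_mono pow) auto
  also have "\<dots> = (\<Sum>m\<in>?A. (coeff \<rho> m)\<^sup>2)" by (simp add: coeff_sq)
  also have "\<dots> \<le> energy \<rho> X" unfolding energy_def by (intro sum_mono2) auto
  finally show ?thesis unfolding \<rho>_def .
qed

text \<open>The second moment of the oscillation is at least \<open>1/2 L\<^sup>2 D\<close> minus \<open>C\<^sup>2 R\<^sup>2 (1 + ln R)\<close>, with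
\<open>D \<ge> \<kappa> ln R - \<mu>\<close> and \<open>R = M / K \<le> 3 L / K\<close>; enlarging \<open>K\<close> makes the error at most half of the main term up to
constants. Passing from the oscillation to \<open>ln P\<^sub>N - 1/2 ln M\<close> changes values by a constant
depending on \<open>K\<close>, which is negligible against \<open>ln M\<close>.\<close>

lemma variance_lower:
  assumes c: "0 < c" "c \<le> 1/2" "\<And>q::nat. q \<ge> 1 \<Longrightarrow> c \<le> real q * dist_nearest_int (real q * \<alpha>)"
  obtains \<kappa> M\<^sub>0 where "\<kappa> > 0"
    "\<And>M::nat. M \<ge> M\<^sub>0 \<Longrightarrow>
      \<kappa> * ln (real M) \<le> (1 / real M) * (\<Sum>N=1..M. (ln (sudler N \<alpha>) - (1/2) * ln (real M))\<^sup>2)"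
proof -
  define \<mu> where "\<mu> = exp (- 8) / (4 * pi\<^sup>2)"
  define \<kappa> where "\<kappa> = \<mu> / ln (2 / c)"
  have \<mu>: "\<mu> > 0" by (simp add: \<mu>_def)
  have "ln (2 / c) > 0" using c by simp
  then have \<kappa>: "\<kappa> > 0" using \<mu> by (simp add: \<kappa>_def)
  \<comment> \<open>Chosen so that the off-diagonal error has coefficient \<open>9 C\<^sup>2 / K\<^sup>2 \<le> \<kappa> / 4\<close>, half of the main coefficient.\<close>
  define K where "K = 1 + 36 * C\<^sup>2 / \<kappa>"
  have K: "K \<ge> 1" using \<kappa> by (simp add: K_def)
  have K_large: "9 * C\<^sup>2 / K\<^sup>2 \<le> \<kappa> / 4"
  proof -
    have "36 * C\<^sup>2 \<le> \<kappa> * K" using \<kappa> by (simp add: K_def distrib_left)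
    also have "\<dots> \<le> \<kappa> * K\<^sup>2" using \<kappa> K by (simp add: power2_eq_square)
    finally show ?thesis using K by (simp add: field_simps)
  qed
  define E where "E = C * K\<^sup>2 + 2 * K + 2 + 1/2 * ln K"
  define B where "B = \<kappa> / 24 * ln K + \<mu> / 12 + \<kappa> / 24 + E\<^sup>2"
  have main: "\<kappa> / 48 * ln (real M) \<le> (1 / real M) * (\<Sum>N=1..M. (ln (sudler N \<alpha>) - (1/2) * ln (real M))\<^sup>2)"
    if M: "M \<ge> 3" "2 * K \<le> real M" "48 * B / \<kappa> \<le> ln (real M)" for M
  proof -
    define R where "R = real M / K"
    have R: "R \<ge> 2" "K * R = real M" using M K by (auto simp: R_def field_simps)
    have lnR: "ln R = ln (real M) - ln K" using M K by (simp add: R_def ln_div)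
    define \<rho> where "\<rho> = 1 - 1 / R"
    have \<rho>: "0 \<le> \<rho>" "\<rho> < 1" "1 - \<rho> = 1 / R" "- ln (1 - \<rho>) = ln R"
      using R by (auto simp: \<rho>_def ln_div)
    obtain X where X: "R \<le> real X" "\<And>N. real N \<le> K * R \<Longrightarrow>
      \<bar>ln (sudler N \<alpha>) - 1/2 * ln R + oscillation \<rho> X (real N + 1/2)\<bar> \<le> C * K\<^sup>2 + 2 * K + 2"
      unfolding \<rho>_def using ln_sudler_approx[OF R(1) K] by auto
    let ?Y = "\<lambda>N. oscillation \<rho> X (real N + 1/2)"
    define S where "S = (\<Sum>N=1..M. (?Y N)\<^sup>2)"
    have S0: "S \<ge> 0" unfolding S_def by (intro sum_nonneg) auto
    define b where "b = \<kappa> / 4 * ln R - \<mu> / 2 - \<kappa> / 4"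
    define L where "L = M div 2"
    have L: "real L > 0" "2 * L \<le> M" "real M \<le> 3 * real L" using M(1) by (auto simp: L_def)
    have "energy \<rho> X \<ge> exp (- 8) / 4 * ((ln R / ln (2 / c) - 1) / pi\<^sup>2)"
      unfolding \<rho>_def by (rule energy_ge[OF c R(1) X(1)])
    moreover have "exp (- 8) / 4 * ((ln R / ln (2 / c) - 1) / pi\<^sup>2) = \<kappa> * ln R - \<mu>"
      by (simp add: \<kappa>_def \<mu>_def right_diff_distrib diff_divide_distrib)
    ultimately have en: "energy \<rho> X \<ge> \<kappa> * ln R - \<mu>" by simp
    have "C\<^sup>2 * (1 - ln (1 - \<rho>)) / (1 - \<rho>)\<^sup>2 = C\<^sup>2 / K\<^sup>2 * (1 + ln R) * (real M)\<^sup>2"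
      unfolding \<rho>(3) using \<rho>(3,4) R K by (simp add: R_def power_divide)
    also have "\<dots> \<le> C\<^sup>2 / K\<^sup>2 * (1 + ln R) * (3 * real L)\<^sup>2"
      using L R by (intro mult_left_mono power_mono) auto
    also have "\<dots> = 9 * C\<^sup>2 / K\<^sup>2 * (1 + ln R) * (real L)\<^sup>2" by (simp add: power_mult_distrib)
    also have "\<dots> \<le> \<kappa> / 4 * (1 + ln R) * (real L)\<^sup>2"
      using R by (intro mult_right_mono K_large) auto
    finally have err: "C\<^sup>2 * (1 - ln (1 - \<rho>)) / (1 - \<rho>)\<^sup>2 \<le> \<kappa> / 4 * (1 + ln R) * (real L)\<^sup>2" .
    have "real L * (real L * b) = 1/2 * (real L)\<^sup>2 * (\<kappa> * ln R - \<mu>) - \<kappa> / 4 * (1 + ln R) * (real L)\<^sup>2"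
      by (simp add: b_def power2_eq_square field_simps)
    also have "\<dots> \<le> 1/2 * (real L)\<^sup>2 * energy \<rho> X - C\<^sup>2 * (1 - ln (1 - \<rho>)) / (1 - \<rho>)\<^sup>2"
      by (intro diff_mono mult_left_mono en err) auto
    also have "\<dots> \<le> (\<Sum>i<L. \<Sum>k<L. (oscillation \<rho> X (real L + 1/2 + real i - real k))\<^sup>2)"
      using second_moment[OF \<rho>(1,2), where L = L and X = X and t = "real L + 1/2"] by linarith
    also have "\<dots> \<le> real L * S"
      unfolding S_def by (rule double_sum_le_sum[OF _ L(2)]) simp
    finally have Lb: "real L * b \<le> S" using L by (simp only: mult_le_cancel_left_pos)
    \<comment> \<open>The case \<open>b < 0\<close> is trivial, which avoids a further lower bound on \<open>M\<close>.\<close>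
    have Mb: "real M / 3 * b \<le> S"
    proof (cases "b \<ge> 0")
      case True
      then have "real M / 3 * b \<le> real L * b" using L by (intro mult_right_mono) auto
      with Lb show ?thesis by linarith
    next
      case False
      then have "real M / 3 * b \<le> 0" by (intro mult_nonneg_nonpos) auto
      with S0 show ?thesis by linarith
    qed
    have point: "(?Y N)\<^sup>2 / 2 - E\<^sup>2 \<le> (ln (sudler N \<alpha>) - (1/2) * ln (real M))\<^sup>2" if N: "N \<in> {1..M}" for N
    proof -
      define e where "e = ln (sudler N \<alpha>) - 1/2 * ln (real M) + ?Y N"
      have "real N \<le> K * R" using N R(2) by simp
      note X(2)[OF this]
      moreover have "e = (ln (sudler N \<alpha>) - 1/2 * ln R + ?Y N) - 1/2 * ln K"
        by (simp add: e_def lnR field_simps)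
      moreover have "\<bar>1/2 * ln K\<bar> = 1/2 * ln K" using K by simp
      ultimately have "\<bar>e\<bar> \<le> E" unfolding E_def
        by (metis abs_triangle_ineq4 add_right_mono order.trans)
      then have "\<bar>e\<bar> \<le> \<bar>E\<bar>" by linarith
      then have e: "e\<^sup>2 \<le> E\<^sup>2" by (simp only: abs_le_square_iff)
      have "(?Y N)\<^sup>2 / 2 - e\<^sup>2 \<le> (e - ?Y N)\<^sup>2"
        using zero_le_power2[of "2 * e - ?Y N"] by (simp add: power2_eq_square algebra_simps)
      moreover have "e - ?Y N = ln (sudler N \<alpha>) - (1/2) * ln (real M)" by (simp add: e_def)
      ultimately show ?thesis using e by simp
    qed
    have "\<kappa> / 48 * ln (real M) \<le> \<kappa> / 24 * ln (real M) - B"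
      using M(3) \<kappa> by (simp add: field_simps)
    also have "\<dots> = b / 6 - E\<^sup>2" by (simp add: b_def B_def lnR field_simps)
    finally have "real M * (\<kappa> / 48 * ln (real M)) \<le> real M * (b / 6 - E\<^sup>2)"
      by (intro mult_left_mono) auto
    also have "\<dots> = 1/2 * (real M / 3 * b) - real M * E\<^sup>2" by (simp add: algebra_simps)
    also have "\<dots> \<le> 1/2 * S - real M * E\<^sup>2" using Mb by (simp add: mult_ac)
    also have "\<dots> = (\<Sum>N=1..M. (?Y N)\<^sup>2 / 2 - E\<^sup>2)"
      by (simp add: S_def sum_subtractf sum_divide_distrib)
    also have "\<dots> \<le> (\<Sum>N=1..M. (ln (sudler N \<alpha>) - (1/2) * ln (real M))\<^sup>2)"
      by (intro sum_mono point)
    finally show ?thesis using M(1) by (simp add: field_simps)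
  qed
  define M\<^sub>0 where "M\<^sub>0 = 3 + nat \<lceil>2 * K\<rceil> + nat \<lceil>exp (48 * B / \<kappa>)\<rceil>"
  show ?thesis
  proof (rule that[of "\<kappa> / 48" M\<^sub>0])
    fix M assume M: "M \<ge> M\<^sub>0"
    have "exp (48 * B / \<kappa>) \<le> real M" using M unfolding M\<^sub>0_def by linarith
    moreover have "M \<ge> 3" "2 * K \<le> real M" using M unfolding M\<^sub>0_def by linarith+
    ultimately show "\<kappa> / 48 * ln (real M) \<le> (1 / real M) * (\<Sum>N=1..M. (ln (sudler N \<alpha>) - (1/2) * ln (real M))\<^sup>2)"
      by (intro main) (auto simp: ln_ge_iff)
  qed (use \<kappa> in simp)
qed

end

theorem mainTheorem2:
  fixes \<alpha> :: real
  assumes "badly_approximable \<alpha>"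
  shows "(\<exists>C>0. \<forall>M::nat. M \<ge> 3 \<longrightarrow>
            \<bar>(1 / real M) * (\<Sum>N=1..M. ln (sudler N \<alpha>)) - (1/2) * ln (real M)\<bar>
              \<le> C * ln (ln (real M)))
       \<and> (\<exists>C\<^sub>1>0. \<exists>C\<^sub>2>0. \<forall>M::nat. M \<ge> 3 \<longrightarrow>
            \<bar>ln (real M)\<bar>
              \<le> C\<^sub>1 * ((1 / real M) * (\<Sum>N=1..M. (ln (sudler N \<alpha>) - (1/2) * ln (real M))^2))
          \<and> \<bar>(1 / real M) * (\<Sum>N=1..M. (ln (sudler N \<alpha>) - (1/2) * ln (real M))^2)\<bar>
              \<le> C\<^sub>2 * ln (real M))"
proof -
  obtain c\<^sub>0 where c\<^sub>0: "c\<^sub>0 > 0" "\<And>q::nat. q \<ge> 1 \<Longrightarrow> c\<^sub>0 \<le> real q * dist_nearest_int (real q * \<alpha>)"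
    using badly_approximable_lower[OF assms] by metis
  define c where "c = min c\<^sub>0 (1/2)"
  have c: "0 < c" "c \<le> 1/2" "\<And>q::nat. q \<ge> 1 \<Longrightarrow> c \<le> real q * dist_nearest_int (real q * \<alpha>)"
    using c\<^sub>0 by (auto simp: c_def min.coboundedI1)
  define C where "C = 16 / c\<^sup>2"
  interpret csc_growth \<alpha> C
  proof
    fix j :: nat assume j: "j \<ge> 1"
    have "0 < real j * dist_nearest_int (real j * \<alpha>)" using c(1) c(3)[OF j] by linarith
    then have "0 < dist_nearest_int (real j * \<alpha>)" using j by (simp add: zero_less_mult_iff)
    then show "sin (pi * real j * \<alpha>) \<noteq> 0"
      using abs_sin_pi_ge_dist[of "real j * \<alpha>"] by (auto simp: mult.assoc)
  next
    show "(\<Sum>j=1..n. csc_sq \<alpha> j) \<le> C * (real n)\<^sup>2" for n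
      unfolding C_def by (rule sum_csc_sq_le[OF c(1,3)])
  qed
  define V where "V M = (1 / real M) * (\<Sum>N=1..M. (ln (sudler N \<alpha>) - (1/2) * ln (real M))\<^sup>2)" for M
  have V_pos: "V M > 0" if "M \<ge> 3" for M
    using variance_positive[OF that] that by (simp add: V_def)
  have ln_pos: "ln (real M) \<ge> 0" for M by (cases "M = 0") auto
  have mean: "\<exists>A>0. \<forall>M::nat. M \<ge> 3 \<longrightarrow>
      \<bar>(1 / real M) * (\<Sum>N=1..M. ln (sudler N \<alpha>)) - (1/2) * ln (real M)\<bar> \<le> A * ln (ln (real M))"
  proof (intro exI conjI allI impI)
    have l: "ln (ln (3::real)) > 0" using ln3_gt_1 by simp
    then show "(2 * C + 4) / ln (ln 3) > 0" using C_ge_1 by simp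
    fix M :: nat assume M: "M \<ge> 3"
    have "ln (ln (3::real)) \<le> ln (ln (real M))" using M ln3_gt_1 by (intro ln_mono) auto
    then have "(2 * C + 4) / ln (ln 3) * ln (ln 3) \<le> (2 * C + 4) / ln (ln 3) * ln (ln (real M))"
      using l C_ge_1 by (intro mult_left_mono) auto
    with mean_log_sudler[OF M] l
    show "\<bar>(1 / real M) * (\<Sum>N=1..M. ln (sudler N \<alpha>)) - (1/2) * ln (real M)\<bar>
        \<le> (2 * C + 4) / ln (ln 3) * ln (ln (real M))" by simp
  qed
  obtain \<kappa> M\<^sub>0 where \<kappa>: "\<kappa> > 0" "\<And>M::nat. M \<ge> M\<^sub>0 \<Longrightarrow> \<kappa> * ln (real M) \<le> V M"
    unfolding V_def using variance_lower[OF c] by metis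
  \<comment> \<open>A constant that covers all small \<open>M\<close> at once, since each summand is nonnegative.\<close>
  define F where "F = (\<Sum>M=3..M\<^sub>0. ln (real M) / V M)"
  have quot: "0 \<le> ln (real M) / V M" if "M \<ge> 3" for M
    using ln_pos[of M] V_pos[OF that] by simp
  have F: "F \<ge> 0" unfolding F_def by (intro sum_nonneg quot) auto
  have lower: "ln (real M) \<le> (1 / \<kappa> + F) * V M" if M: "M \<ge> 3" for M
  proof (cases "M \<ge> M\<^sub>0")
    case True
    then have "ln (real M) \<le> 1 / \<kappa> * V M" using \<kappa> by (simp add: field_simps)
    moreover have "0 \<le> F * V M" using F V_pos[OF M] by simp
    ultimately show ?thesis by (simp add: distrib_right)
  next
    case False
    then have "ln (real M) / V M \<le> F"
      unfolding F_def using M quot by (intro member_le_sum) auto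
    then have "ln (real M) \<le> F * V M" using V_pos[OF M] by (simp add: field_simps)
    moreover have "0 \<le> 1 / \<kappa> * V M" using \<kappa>(1) V_pos[OF M] by simp
    ultimately show ?thesis by (simp add: distrib_right)
  qed
  define A where "A = 2 * C + 4 * C\<^sup>2 + 2 * (C + 4)\<^sup>2"
  have A: "A > 0" unfolding A_def using C_ge_1 by (intro add_pos_nonneg) auto
  have upper: "V M \<le> A * ln (real M)" if "M \<ge> 3" for M
    unfolding V_def A_def by (rule variance_upper[OF that])
  have "\<bar>ln (real M)\<bar> \<le> (1 / \<kappa> + F) * V M \<and> \<bar>V M\<bar> \<le> A * ln (real M)" if "M \<ge> 3" for M
    using lower[OF that] upper[OF that] V_pos[OF that] ln_pos[of M] by simp
  moreover have "1 / \<kappa> + F > 0" using \<kappa>(1) F by (intro add_pos_nonneg) auto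
  ultimately show ?thesis
    using mean A unfolding V_def by blast
qed

end
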